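(* Let $A$ be a semiprime coherent quantale. The following are equivalent: (1) $A$ is a $PP$-quantale; (2) the reticulation $L(A)$ is a Stone lattice; (3) $L(A)$ is a conormal lattice and $\mathrm{Min}_{Id,Z}(L(A))$ is compact; (4) $A$ is a $PF$-quantale and $\mathrm{Min}_Z(A)$ is compact; (5) $A$ is a $PF$-quantale and $\mathrm{Min}_Z(A)$ is a Boolean space; (6) $A$ is an $mp$-quantale and $\mathrm{Min}_Z(A)$ is a Boolean space; (7) $\mathrm{Spec}_F(A)$ is a normal space and $\mathrm{Min}_Z(A)$ is a Boolean space.
   Context: A quantale is a complete lattice $(A,\vee,\wedge,0,1)$ with an associative multiplication distributing over arbitrary joins in each variable. All quantales are assumed commutative and integral ($1$ is the multiplicative unit). $K(A)$ is the set of compact elements. $A$ is algebraic if every element is a join of compact elements; $A$ is coherent if it is algebraic, $1\in K(A)$ and $K(A)$ is closed under multiplication. $a^{\perp}=\bigvee\{x\in A: ax=0\}$. $B(A)$ is the set of complemented elements (those $e$ with $e\vee e^{\perp}=1$). An element $p<1$ is $m$-prime if $ab\le p$ implies $a\le p$ or $b\le p$; $\mathrm{Spec}(A)$ is the set of $m$-prime elements and $\mathrm{Min}(A)$ the set of minimal ones; $A$ is semiprime if $\bigwedge\mathrm{Spec}(A)=0$. $V(a)=\{p\in\mathrm{Spec}(A): a\le p\}$. $\mathrm{Spec}_Z(A)$ is $\mathrm{Spec}(A)$ with closed sets $V(a)$, $a\in A$; $\mathrm{Spec}_F(A)$ is $\mathrm{Spec}(A)$ with the flat topology, having $\{V(c):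 c\in K(A)\}$ as a basis of open sets. $\mathrm{Min}_Z(A)$ is $\mathrm{Min}(A)$ as a subspace of $\mathrm{Spec}_Z(A)$. For a bounded distributive lattice $L$, $\mathrm{Min}_{Id,Z}(L)$ is the set of minimal prime ideals of $L$ with the Stone topology (basic open sets $\{P: x\notin P\}$, $x\in L$). A Boolean space is a compact Hausdorff space with a basis of clopen sets; a space is normal if disjoint closed sets have disjoint neighbourhoods ($T_1$ is not required). $A$ is a $PP$-quantale if $c^{\perp}\in B(A)$ for all $c\in K(A)$. An element $a$ is pure if for all $c\in K(A)$, $c\le a$ implies $a\vee c^{\perp}=1$; $A$ is a $PF$-quantale if $c^{\perp}$ is pure for all $c\in K(A)$. $A$ is an $mp$-quantale if every $p\in\mathrm{Spec}(A)$ has a unique $q\in\mathrm{Min}(A)$ with $q\le p$. A bounded distributive lattice $L$ is a Stone lattice if for every $x\in L$ there is a complemented $e\in L$ with $\{y: x\wedge y=0\}=\{y: y\le e\}$; it is conormal if for all $x,y$ with $x\wedge y=0$ there are $u,v$ with $x\wedge u=y\wedge v=0$ and $u\vee v=1$. The reticulation of a coherent quantale $A$ is the (unique up to isomorphism) bounded distributive lattice $L(A)$ together with a surjective map $\lambda_A:K(A)\to L(A)$ such that for all $a,b\in K(A)$: $\lambda_A(a\vee b)\le\lambda_A(a)\vee\lambda_A(b)$; $\lambda_A(ab)=\lambda_A(a)\wedge\lambda_A(b)$; $\lambda_A(a)\le\lambda_A(b)$ iff $a^n\le b$ for some integer $n\ge1$. *)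

theory Defs
  imports "HOL-Analysis.Analysis"
begin

section \<open>Coherent quantales\<close>

text \<open>The zero of a quantale is \<open>bot\<close>; the symbol \<open>0\<close> is not used.  Since multiplication is
  commutative, distributivity in one variable suffices.  Integrality is \<open>one_eq_top\<close>.\<close>

class comm_integral_quantale = complete_lattice + comm_monoid_mult +
  assumes mult_Sup: "a * Sup S = Sup ((*) a ` S)"
    and one_eq_top: "1 = top"

definition (in complete_lattice) compact_elems :: "'a set" where
  "compact_elems = {c. \<forall>S. c \<le> Sup S \<longrightarrow> (\<exists>F. finite F \<and> F \<subseteq> S \<and> c \<le> Sup F)}"

class coherent_quantale = comm_integral_quantale +
  assumes algebraic: "\<exists>S. S \<subseteq> compact_elems \<and> a = Sup S"
    and one_compact: "1 \<in> compact_elems"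
    and mult_compact: "\<lbrakk>a \<in> compact_elems; b \<in> compact_elems\<rbrakk> \<Longrightarrow> a * b \<in> compact_elems"

definition annih :: "'a::comm_integral_quantale \<Rightarrow> 'a" where
  "annih a = Sup {x. a * x = bot}"

definition complemented_elems :: "'a::comm_integral_quantale set" where
  "complemented_elems = {e. sup e (annih e) = 1}"

definition m_prime :: "'a::comm_integral_quantale \<Rightarrow> bool" where
  "m_prime p \<longleftrightarrow> p < 1 \<and> (\<forall>a b. a * b \<le> p \<longrightarrow> a \<le> p \<or> b \<le> p)"

definition Spec :: "'a::comm_integral_quantale set" where
  "Spec = {p. m_prime p}"

definition Min_Spec :: "'a::comm_integral_quantale set" where
  "Min_Spec = {p \<in> Spec. \<forall>q \<in> Spec. q \<le> p \<longrightarrow> q = p}"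

definition V :: "'a::comm_integral_quantale \<Rightarrow> 'a set" where
  "V a = {p \<in> Spec. a \<le> p}"

definition pure :: "'a::comm_integral_quantale \<Rightarrow> bool" where
  "pure a \<longleftrightarrow> (\<forall>c \<in> compact_elems. c \<le> a \<longrightarrow> sup a (annih c) = 1)"

definition semiprime_quantale :: "'a::comm_integral_quantale itself \<Rightarrow> bool" where
  "semiprime_quantale T \<longleftrightarrow> Inf (Spec :: 'a set) = bot"

definition PP_quantale :: "'a::comm_integral_quantale itself \<Rightarrow> bool" where
  "PP_quantale T \<longleftrightarrow> (\<forall>c \<in> (compact_elems :: 'a set). annih c \<in> complemented_elems)"

definition PF_quantale :: "'a::comm_integral_quantale itself \<Rightarrow> bool" where
  "PF_quantale T \<longleftrightarrow> (\<forall>c \<in> (compact_elems :: 'a set). pure (annih c))"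

definition mp_quantale :: "'a::comm_integral_quantale itself \<Rightarrow> bool" where
  "mp_quantale T \<longleftrightarrow> (\<forall>p \<in> (Spec :: 'a set). \<exists>!q. q \<in> Min_Spec \<and> q \<le> p)"

section \<open>Topologies on the spectrum\<close>

definition Spec_Z :: "'a::comm_integral_quantale topology" where
  "Spec_Z = topology (\<lambda>U. \<exists>a. U = Spec - V a)"

definition Min_Z :: "'a::comm_integral_quantale topology" where
  "Min_Z = subtopology Spec_Z Min_Spec"

definition Spec_F :: "'a::comm_integral_quantale topology" where
  "Spec_F = topology (arbitrary union_of (\<lambda>U. \<exists>c \<in> compact_elems. U = V c))"

definition Boolean_space :: "'b topology \<Rightarrow> bool" where
  "Boolean_space X \<longleftrightarrow> compact_space X \<and> Hausdorff_space X \<and>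
     (\<exists>\<B>. (\<forall>B \<in> \<B>. openin X B \<and> closedin X B) \<and>
          openin X = arbitrary union_of (\<lambda>B. B \<in> \<B>))"

lemma V_subset_Spec: "V a \<subseteq> Spec"
  by (auto simp: V_def)

lemma V_Sup: "V (Sup S) = Spec \<inter> (\<Inter>a\<in>S. V a)"
  by (auto simp: V_def Sup_le_iff)

lemma mult_le_left: "a * b \<le> (a :: 'a::comm_integral_quantale)"
proof -
  have "Sup {b, 1} = (1 :: 'a)"
    by (simp add: one_eq_top)
  then have "a = a * Sup {b, 1}"
    by simp
  also have "\<dots> = sup (a * b) a"
    by (simp only: mult_Sup) simp
  finally show ?thesis
    by (metis sup_ge1)
qed

lemma mult_le_right: "a * b \<le> (b :: 'a::comm_integral_quantale)"
  by (metis mult.commute mult_le_left)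

lemma V_mult: "V (a * b) = V a \<union> V b"
proof -
  have "a * b \<le> p" if "a \<le> p \<or> b \<le> p" for p
    using that mult_le_left[of a b] mult_le_right[of a b] by (meson order_trans)
  then show ?thesis
    by (auto simp: V_def Spec_def m_prime_def)
qed

lemma istopology_Spec_Z: "istopology (\<lambda>U. \<exists>a::'a::comm_integral_quantale. U = Spec - V a)"
proof -
  have "\<exists>a. (Spec - V b) \<inter> (Spec - V c) = Spec - V a" for b c :: 'a
    by (rule exI[of _ "b * c"]) (auto simp: V_mult)
  moreover have "\<exists>a. \<Union>\<K> = Spec - V a"
    if \<K>: "\<forall>K\<in>\<K>. \<exists>a::'a. K = Spec - V a" for \<K>
  proof -
    obtain f where f: "\<And>K. K \<in> \<K> \<Longrightarrow> K = Spec - V (f K :: 'a)"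
      using \<K> by metis
    have "\<Union>\<K> = (\<Union>K\<in>\<K>. Spec - V (f K))"
      using f by auto
    also have "\<dots> = Spec - V (Sup (f ` \<K>))"
      by (auto simp: V_Sup)
    finally show ?thesis by blast
  qed
  ultimately show ?thesis
    unfolding istopology_def by blast
qed

lemma openin_Spec_Z: "openin Spec_Z U \<longleftrightarrow> (\<exists>a. U = Spec - V a)"
  unfolding Spec_Z_def by (simp add: istopology_Spec_Z)

lemma topspace_Spec_Z: "topspace Spec_Z = (Spec :: 'a::comm_integral_quantale set)"
proof
  have "Spec = Spec - V (1 :: 'a)"
    by (auto simp: V_def Spec_def m_prime_def)
  then have "openin Spec_Z (Spec :: 'a set)"
    unfolding openin_Spec_Z by blast
  then show "(Spec :: 'a set) \<subseteq> topspace Spec_Z"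
    by (rule openin_subset)
next
  have "openin Spec_Z (topspace (Spec_Z :: 'a topology))"
    by (rule openin_topspace)
  then show "topspace Spec_Z \<subseteq> (Spec :: 'a set)"
    unfolding openin_Spec_Z by blast
qed

lemma closedin_Spec_Z: "closedin Spec_Z C \<longleftrightarrow> (\<exists>a. C = V a)"
proof
  assume "closedin Spec_Z C"
  then obtain a where a: "C \<subseteq> Spec" "Spec - C = Spec - V a"
    unfolding closedin_def openin_Spec_Z topspace_Spec_Z by blast
  then have "C = V a"
    using V_subset_Spec[of a] by blast
  then show "\<exists>a. C = V a" ..
next
  assume "\<exists>a. C = V a"
  then show "closedin Spec_Z C"
    unfolding closedin_def openin_Spec_Z topspace_Spec_Z using V_subset_Spec by blast
qed

lemma compact_elems_bot: "(bot :: 'a::complete_lattice) \<in> compact_elems"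
  by (auto simp: compact_elems_def)

lemma compact_elems_sup:
  assumes "(a :: 'a::complete_lattice) \<in> compact_elems" "b \<in> compact_elems"
  shows "sup a b \<in> compact_elems"
  unfolding compact_elems_def
proof (intro CollectI allI impI)
  fix S assume "sup a b \<le> Sup S"
  then have "a \<le> Sup S" "b \<le> Sup S"
    by simp_all
  from \<open>a \<le> Sup S\<close> obtain F where F: "finite F" "F \<subseteq> S" "a \<le> Sup F"
    using assms(1) unfolding compact_elems_def by blast
  from \<open>b \<le> Sup S\<close> obtain G where G: "finite G" "G \<subseteq> S" "b \<le> Sup G"
    using assms(2) unfolding compact_elems_def by blast
  have "sup a b \<le> Sup (F \<union> G)"
    using F(3) G(3) by (simp only: Sup_union_distrib sup_mono)
  then show "\<exists>H. finite H \<and> H \<subseteq> S \<and> sup a b \<le> Sup H"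
    using F G by (intro exI[of _ "F \<union> G"]) simp
qed

lemma openin_Spec_F:
  "openin Spec_F = arbitrary union_of (\<lambda>U. \<exists>c \<in> compact_elems. U = V c)"
proof -
  have "istopology (arbitrary union_of (\<lambda>U. \<exists>c \<in> compact_elems. U = V (c :: 'a)))"
  proof (rule istopology_base)
    fix S T :: "'a set"
    assume "\<exists>c \<in> compact_elems. S = V c" "\<exists>c \<in> compact_elems. T = V c"
    then obtain c d where cd: "c \<in> compact_elems" "S = V c" "d \<in> compact_elems" "T = V d"
      by (elim bexE)
    have "S \<inter> T = V (sup c d)"
      by (auto simp: cd V_def)
    then show "\<exists>c \<in> compact_elems. S \<inter> T = V c"
      using compact_elems_sup[OF cd(1,3)] by (rule bexI)
  qed
  then show ?thesis
    unfolding Spec_F_def by simp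
qed

lemma topspace_Spec_F: "topspace Spec_F = (Spec :: 'a::comm_integral_quantale set)"
proof
  have "openin Spec_F (V (bot :: 'a))"
    unfolding openin_Spec_F by (rule arbitrary_union_of_inc) (rule bexI[OF refl compact_elems_bot])
  moreover have "V bot = (Spec :: 'a set)"
    by (auto simp: V_def)
  ultimately show "(Spec :: 'a set) \<subseteq> topspace Spec_F"
    by (metis openin_subset)
next
  have "openin Spec_F (topspace (Spec_F :: 'a topology))"
    by (rule openin_topspace)
  then obtain \<U> where \<U>: "\<U> \<subseteq> {U. \<exists>c::'a \<in> compact_elems. U = V c}" "\<Union>\<U> = topspace Spec_F"
    unfolding openin_Spec_F union_of_def by (elim exE conjE)
  show "topspace Spec_F \<subseteq> (Spec :: 'a set)"
    unfolding \<U>(2)[symmetric]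
  proof (rule Union_least)
    fix U assume "U \<in> \<U>"
    with \<U>(1) show "U \<subseteq> Spec"
      by (auto simp: V_def)
  qed
qed

section \<open>Bounded distributive lattices\<close>

definition complemented :: "'l::{bounded_lattice,distrib_lattice} \<Rightarrow> bool" where
  "complemented e \<longleftrightarrow> (\<exists>f. inf e f = bot \<and> sup e f = top)"

definition Stone_lattice :: "'l::{bounded_lattice,distrib_lattice} itself \<Rightarrow> bool" where
  "Stone_lattice T \<longleftrightarrow>
     (\<forall>x::'l. \<exists>e. complemented e \<and> {y. inf x y = bot} = {y. y \<le> e})"

definition conormal_lattice :: "'l::{bounded_lattice,distrib_lattice} itself \<Rightarrow> bool" where
  "conormal_lattice T \<longleftrightarrow>
     (\<forall>x y::'l. inf x y = bot \<longrightarrow>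
        (\<exists>u v. inf x u = bot \<and> inf y v = bot \<and> sup u v = top))"

definition lattice_ideal :: "'l::{bounded_lattice,distrib_lattice} set \<Rightarrow> bool" where
  "lattice_ideal I \<longleftrightarrow> bot \<in> I \<and> (\<forall>x\<in>I. \<forall>y\<in>I. sup x y \<in> I) \<and> (\<forall>x\<in>I. \<forall>y. y \<le> x \<longrightarrow> y \<in> I)"

definition prime_lattice_ideal :: "'l::{bounded_lattice,distrib_lattice} set \<Rightarrow> bool" where
  "prime_lattice_ideal P \<longleftrightarrow> lattice_ideal P \<and> P \<noteq> UNIV \<and>
     (\<forall>x y. inf x y \<in> P \<longrightarrow> x \<in> P \<or> y \<in> P)"

definition min_prime_ideals :: "'l::{bounded_lattice,distrib_lattice} set set" where
  "min_prime_ideals =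
     {P. prime_lattice_ideal P \<and> (\<forall>Q. prime_lattice_ideal Q \<and> Q \<subseteq> P \<longrightarrow> Q = P)}"

definition Min_Id_Z :: "'l::{bounded_lattice,distrib_lattice} set topology" where
  "Min_Id_Z = topology (arbitrary union_of (\<lambda>U. \<exists>x. U = {P \<in> min_prime_ideals. x \<notin> P}))"

lemma prime_lattice_idealD:
  assumes "prime_lattice_ideal P"
  shows "x \<in> P \<Longrightarrow> y \<le> x \<Longrightarrow> y \<in> P" "inf x y \<in> P \<Longrightarrow> x \<in> P \<or> y \<in> P" "P \<noteq> UNIV"
  using assms unfolding prime_lattice_ideal_def lattice_ideal_def by (fast, fast, fast)

lemma openin_Min_Id_Z:
  "openin Min_Id_Z = arbitrary union_of (\<lambda>U. \<exists>x. U = {P \<in> min_prime_ideals. x \<notin> P})"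
proof -
  have iff: "inf x y \<notin> P \<longleftrightarrow> x \<notin> P \<and> y \<notin> P" if "P \<in> min_prime_ideals" for x y :: 'a and P
  proof -
    have P: "prime_lattice_ideal P"
      using that by (simp add: min_prime_ideals_def)
    show ?thesis
      using prime_lattice_idealD(2)[OF P, of x y] prime_lattice_idealD(1)[OF P _ inf_le1]
        prime_lattice_idealD(1)[OF P _ inf_le2] by metis
  qed
  have "istopology (arbitrary union_of (\<lambda>U. \<exists>x::'a. U = {P \<in> min_prime_ideals. x \<notin> P}))"
  proof (rule istopology_base)
    fix S T :: "'a set set"
    assume "\<exists>x. S = {P \<in> min_prime_ideals. x \<notin> P}" "\<exists>x. T = {P \<in> min_prime_ideals. x \<notin> P}"
    then obtain x y where
      "S = {P \<in> min_prime_ideals. x \<notin> P}" "T = {P \<in> min_prime_ideals. y \<notin> P}"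
      by (elim exE)
    then have "S \<inter> T = {P \<in> min_prime_ideals. inf x y \<notin> P}"
      using iff by auto
    then show "\<exists>x. S \<inter> T = {P \<in> min_prime_ideals. x \<notin> P}" ..
  qed
  then show ?thesis
    unfolding Min_Id_Z_def by simp
qed

lemma topspace_Min_Id_Z:
  "topspace Min_Id_Z = (min_prime_ideals :: 'l::{bounded_lattice,distrib_lattice} set set)"
proof
  have "top \<notin> P" if "P \<in> min_prime_ideals" for P :: "'l set"
  proof
    assume "top \<in> P"
    have P: "prime_lattice_ideal P"
      using that by (simp add: min_prime_ideals_def)
    have "x \<in> P" for x
      by (rule prime_lattice_idealD(1)[OF P \<open>top \<in> P\<close> top_greatest])
    then show False
      using prime_lattice_idealD(3)[OF P] by blast
  qed
  then have "min_prime_ideals = {P \<in> min_prime_ideals. (top :: 'l) \<notin> P}"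
    by blast
  then have "openin Min_Id_Z (min_prime_ideals :: 'l set set)"
    unfolding openin_Min_Id_Z by (intro arbitrary_union_of_inc exI)
  then show "(min_prime_ideals :: 'l set set) \<subseteq> topspace Min_Id_Z"
    by (rule openin_subset)
next
  have "openin Min_Id_Z (topspace (Min_Id_Z :: 'l set topology))"
    by (rule openin_topspace)
  then obtain \<U> where \<U>: "\<U> \<subseteq> {U. \<exists>x::'l. U = {P \<in> min_prime_ideals. x \<notin> P}}"
    "\<Union>\<U> = topspace Min_Id_Z"
    unfolding openin_Min_Id_Z union_of_def by (elim exE conjE)
  show "topspace Min_Id_Z \<subseteq> (min_prime_ideals :: 'l set set)"
    unfolding \<U>(2)[symmetric]
  proof (rule Union_least)
    fix U assume "U \<in> \<U>"
    with \<U>(1) show "U \<subseteq> min_prime_ideals"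
      by auto
  qed
qed

section \<open>The reticulation\<close>

text \<open>Only the values of \<open>lam\<close> on compact elements matter.  The lattice \<open>L(A)\<close> is the whole
  type \<open>'l\<close>; it is determined up to isomorphism by the existence of such a map.\<close>

definition reticulation ::
    "('a::coherent_quantale \<Rightarrow> 'l::{bounded_lattice,distrib_lattice}) \<Rightarrow> bool" where
  "reticulation lam \<longleftrightarrow>
     lam ` compact_elems = UNIV \<and>
     (\<forall>a \<in> compact_elems. \<forall>b \<in> compact_elems.
        lam (sup a b) \<le> sup (lam a) (lam b) \<and>
        lam (a * b) = inf (lam a) (lam b) \<and>
        (lam a \<le> lam b \<longleftrightarrow> (\<exists>n\<ge>1. a ^ n \<le> b)))"

text \<open>Every coherent quantale has a reticulation: the sets
  \<open>{a. a compact, a ^ n \<le> c for some n \<ge> 1}\<close> with \<open>c\<close> compact, ordered by inclusion.\<close>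

definition compact_rad :: "'a::coherent_quantale \<Rightarrow> 'a set" where
  "compact_rad c = {a \<in> compact_elems. \<exists>n\<ge>1. a ^ n \<le> c}"

lemma mult_sup_distrib: "a * sup b c = sup (a * b) (a * c :: 'a::comm_integral_quantale)"
  using mult_Sup[of a "{b, c}"] by simp

lemma sup_mult_distrib: "sup b c * a = sup (b * a) (c * a :: 'a::comm_integral_quantale)"
  using mult_sup_distrib[of a b c] by (simp add: mult.commute)

lemma mult_mono_quantale:
  assumes "a \<le> b" "c \<le> d"
  shows "a * c \<le> (b * d :: 'a::comm_integral_quantale)"
proof -
  have right: "x * y \<le> x * z" if "y \<le> z" for x y z :: 'a
    using mult_sup_distrib[of x y z] that by (metis sup.absorb_iff2)
  show ?thesis
    using right[OF assms(2), of a] right[OF assms(1), of d] by (metis mult.commute order_trans)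
qed

lemma power_mono_quantale: "a \<le> b \<Longrightarrow> a ^ n \<le> (b ^ n :: 'a::comm_integral_quantale)"
  by (induction n) (simp_all add: mult_mono_quantale)

lemma power_sup_le: "sup a b ^ (n + m) \<le> sup (a ^ n) (b ^ m :: 'a::comm_integral_quantale)"
proof (induction "n + m" arbitrary: n m)
  case 0
  then show ?case by simp
next
  case (Suc k)
  show ?case
  proof (cases "n = 0 \<or> m = 0")
    case True
    then show ?thesis by (auto simp: one_eq_top)
  next
    case False
    then obtain n' m' where nm: "n = Suc n'" "m = Suc m'"
      by (meson not0_implies_Suc)
    with Suc.hyps(2) have k: "k = n' + m" "k = n + m'" by auto
    have "sup a b ^ (n + m) = sup (a * sup a b ^ k) (b * sup a b ^ k)"
      by (simp add: sup_mult_distrib flip: Suc.hyps(2))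
    also have "\<dots> \<le> sup (a * sup (a ^ n') (b ^ m)) (b * sup (a ^ n) (b ^ m'))"
      using Suc.hyps(1)[OF k(1)] Suc.hyps(1)[OF k(2)]
      by (intro sup_mono mult_mono_quantale) (simp_all flip: k)
    also have "\<dots> \<le> sup (a ^ n) (b ^ m)"
      by (simp add: mult_sup_distrib nm le_supI1 le_supI2 mult_le_right)
    finally show ?thesis .
  qed
qed

lemma compact_rad_subset_iff:
  assumes "a \<in> compact_elems"
  shows "compact_rad a \<subseteq> compact_rad b \<longleftrightarrow> (\<exists>n\<ge>1. a ^ n \<le> b)"
proof
  assume "compact_rad a \<subseteq> compact_rad b"
  moreover have "a \<in> compact_rad a"
    using assms unfolding compact_rad_def by (auto intro: exI[of _ "1::nat"])
  ultimately show "\<exists>n\<ge>1. a ^ n \<le> b"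
    by (auto simp: compact_rad_def)
next
  assume "\<exists>n\<ge>1. a ^ n \<le> b"
  then obtain n where n: "n \<ge> 1" "a ^ n \<le> b" by blast
  show "compact_rad a \<subseteq> compact_rad b"
  proof
    fix x assume "x \<in> compact_rad a"
    then obtain m where m: "x \<in> compact_elems" "m \<ge> 1" "x ^ m \<le> a"
      by (auto simp: compact_rad_def)
    have "x ^ (m * n) \<le> b"
      using power_mono_quantale[OF m(3), of n] n(2) by (simp add: power_mult)
    then show "x \<in> compact_rad b"
      using m n unfolding compact_rad_def by (auto intro!: exI[of _ "m * n"])
  qed
qed

lemma compact_rad_mono: "a \<le> b \<Longrightarrow> compact_rad a \<subseteq> compact_rad b"
  by (auto simp: compact_rad_def intro: order_trans)

lemma compact_rad_mult: "compact_rad (a * b) = compact_rad a \<inter> compact_rad b"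
proof
  have "x \<in> compact_rad a \<and> x \<in> compact_rad b" if "x \<in> compact_rad (a * b)" for x
    using that mult_le_left[of a b] mult_le_right[of a b]
    unfolding compact_rad_def by (blast intro: order_trans)
  then show "compact_rad (a * b) \<subseteq> compact_rad a \<inter> compact_rad b" by blast
next
  show "compact_rad a \<inter> compact_rad b \<subseteq> compact_rad (a * b)"
  proof
    fix x assume "x \<in> compact_rad a \<inter> compact_rad b"
    then obtain n m where x: "x \<in> compact_elems" "n \<ge> 1" "x ^ n \<le> a" "x ^ m \<le> b"
      by (auto simp: compact_rad_def)
    then have "x ^ (n + m) \<le> a * b"
      by (simp add: power_add mult_mono_quantale)
    with x show "x \<in> compact_rad (a * b)"
      unfolding compact_rad_def by (auto intro!: exI[of _ "n + m"])
  qed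
qed

lemma compact_rad_sup_subset_iff:
  assumes "a \<in> compact_elems" "b \<in> compact_elems"
  shows "compact_rad (sup a b) \<subseteq> compact_rad c \<longleftrightarrow>
         compact_rad a \<subseteq> compact_rad c \<and> compact_rad b \<subseteq> compact_rad c"
  unfolding assms[THEN compact_rad_subset_iff]
    compact_rad_subset_iff[OF compact_elems_sup[OF assms]]
proof
  assume "\<exists>n\<ge>1. sup a b ^ n \<le> c"
  then show "(\<exists>n\<ge>1. a ^ n \<le> c) \<and> (\<exists>n\<ge>1. b ^ n \<le> c)"
    by (meson order_trans power_mono_quantale sup_ge1 sup_ge2)
next
  assume "(\<exists>n\<ge>1. a ^ n \<le> c) \<and> (\<exists>n\<ge>1. b ^ n \<le> c)"
  then obtain n m where "n \<ge> 1" "m \<ge> 1" "a ^ n \<le> c" "b ^ m \<le> c" by blast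
  then show "\<exists>n\<ge>1. sup a b ^ n \<le> c"
    using power_sup_le[of a b n m] by (intro exI[of _ "n + m"]) (auto intro: order_trans)
qed

typedef (overloaded) 'a retic = "compact_rad ` (compact_elems :: 'a::coherent_quantale set)"
  using one_compact by blast

definition retic :: "'a::coherent_quantale \<Rightarrow> 'a retic" where
  "retic c = Abs_retic (compact_rad c)"

lemma Rep_retic_retic: "c \<in> compact_elems \<Longrightarrow> Rep_retic (retic c) = compact_rad c"
  by (simp add: retic_def Abs_retic_inverse)

lemma retic_cases:
  obtains c where "c \<in> compact_elems" "x = retic c"
  using Rep_retic[of x] Rep_retic_inverse[of x] unfolding retic_def by (metis imageE)

instantiation retic :: (coherent_quantale) "{bounded_lattice,distrib_lattice}"
begin

definition "x \<le> y \<longleftrightarrow> Rep_retic x \<subseteq> Rep_retic y"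
definition "x < y \<longleftrightarrow> Rep_retic x \<subset> Rep_retic y"
definition "bot = retic bot"
definition "top = retic 1"
definition "inf x y = Abs_retic (Rep_retic x \<inter> Rep_retic y)"
definition "sup x y =
  (SOME z. \<exists>a \<in> compact_elems. \<exists>b \<in> compact_elems. x = retic a \<and> y = retic b \<and> z = retic (sup a b))"

lemma retic_le_iff:
  "\<lbrakk>a \<in> compact_elems; b \<in> compact_elems\<rbrakk> \<Longrightarrow> retic a \<le> retic b \<longleftrightarrow> compact_rad a \<subseteq> compact_rad b"
  by (simp add: less_eq_retic_def Rep_retic_retic)

lemma retic_eq_iff:
  "\<lbrakk>a \<in> compact_elems; b \<in> compact_elems\<rbrakk> \<Longrightarrow> retic a = retic b \<longleftrightarrow> compact_rad a = compact_rad b"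
  by (metis Rep_retic_retic retic_def)

lemma inf_retic:
  "\<lbrakk>a \<in> compact_elems; b \<in> compact_elems\<rbrakk> \<Longrightarrow> inf (retic a) (retic b) = retic (a * b)"
  by (simp add: inf_retic_def Rep_retic_retic retic_def[of "a * b"] compact_rad_mult)

lemma sup_retic:
  assumes "a \<in> compact_elems" "b \<in> compact_elems"
  shows "sup (retic a) (retic b) = retic (sup a b)"
proof -
  have eq: "retic (sup a' b') = retic (sup a b)"
    if "a' \<in> compact_elems" "b' \<in> compact_elems" "retic a = retic a'" "retic b = retic b'" for a' b'
  proof -
    have eqs: "compact_rad a' = compact_rad a" "compact_rad b' = compact_rad b"
      using that assms by (simp_all add: retic_eq_iff)
    have "compact_rad (sup a' b') = compact_rad (sup a b)"
    proof
      show "compact_rad (sup a' b') \<subseteq> compact_rad (sup a b)"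
        using compact_rad_sup_subset_iff[OF assms, of "sup a b"]
        unfolding compact_rad_sup_subset_iff[OF that(1,2)] eqs by simp
      show "compact_rad (sup a b) \<subseteq> compact_rad (sup a' b')"
        using compact_rad_sup_subset_iff[OF that(1,2), of "sup a' b'"]
        unfolding compact_rad_sup_subset_iff[OF assms] eqs by simp
    qed
    then show ?thesis
      by (simp add: retic_def)
  qed
  show ?thesis
    unfolding sup_retic_def
  proof (rule some_equality)
    show "\<exists>a' \<in> compact_elems. \<exists>b' \<in> compact_elems.
        retic a = retic a' \<and> retic b = retic b' \<and> retic (sup a b) = retic (sup a' b')"
      by (intro bexI[OF _ assms(1)] bexI[OF _ assms(2)] conjI refl)
  next
    fix z
    assume "\<exists>a' \<in> compact_elems. \<exists>b' \<in> compact_elems.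
        retic a = retic a' \<and> retic b = retic b' \<and> z = retic (sup a' b')"
    then show "z = retic (sup a b)"
      by (elim bexE conjE) (simp only: eq)
  qed
qed

instance
proof
  fix x y z :: "'a retic"
  obtain a b c where abc: "a \<in> compact_elems" "x = retic a" "b \<in> compact_elems" "y = retic b"
    "c \<in> compact_elems" "z = retic c"
    by (metis retic_cases)
  note simps = abc inf_retic sup_retic retic_le_iff retic_eq_iff mult_compact compact_elems_sup
    compact_rad_mult
  show "x < y \<longleftrightarrow> x \<le> y \<and> \<not> y \<le> x"
    by (auto simp: less_eq_retic_def less_retic_def)
  show "x \<le> x"
    by (simp add: less_eq_retic_def)
  show "x \<le> z" if "x \<le> y" "y \<le> z"
    using that by (auto simp: less_eq_retic_def)
  show "x = y" if "x \<le> y" "y \<le> x"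
    using that by (auto simp: less_eq_retic_def Rep_retic_inject)
  show "inf x y \<le> x" "inf x y \<le> y"
    by (simp_all add: simps)
  show "x \<le> inf y z" if "x \<le> y" "x \<le> z"
    using that by (simp add: simps)
  show "x \<le> sup x y" "y \<le> sup x y"
    using compact_rad_sup_subset_iff[of a b "sup a b"] by (simp_all add: simps)
  show "sup y z \<le> x" if "y \<le> x" "z \<le> x"
    using that by (simp add: simps compact_rad_sup_subset_iff)
  show "bot \<le> x"
    by (simp add: bot_retic_def simps compact_elems_bot compact_rad_subset_iff)
      (auto intro: exI[of _ "1::nat"])
  show "x \<le> top"
    unfolding top_retic_def abc(2)
    by (subst retic_le_iff) (use abc one_compact in \<open>auto simp: compact_rad_def one_eq_top\<close>)
  have "compact_rad (sup a (b * c)) = compact_rad (sup a b) \<inter> compact_rad (sup a c)"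
  proof
    show "compact_rad (sup a (b * c)) \<subseteq> compact_rad (sup a b) \<inter> compact_rad (sup a c)"
      by (intro Int_greatest compact_rad_mono sup_mono order_refl mult_le_left mult_le_right)
    have "sup a b * sup a c \<le> sup a (b * c)"
      by (simp add: mult_sup_distrib sup_mult_distrib le_supI1 mult_le_left mult_le_right)
    then have "compact_rad (sup a b * sup a c) \<subseteq> compact_rad (sup a (b * c))"
      by (rule compact_rad_mono)
    then show "compact_rad (sup a b) \<inter> compact_rad (sup a c) \<subseteq> compact_rad (sup a (b * c))"
      by (simp add: compact_rad_mult)
  qed
  then show "sup x (inf y z) = inf (sup x y) (sup x z)"
    by (simp add: simps)
qed

end

lemma reticulation_retic: "reticulation (retic :: 'a::coherent_quantale \<Rightarrow> 'a retic)"
  unfolding reticulation_def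
proof (intro conjI ballI)
  show "retic ` compact_elems = (UNIV :: 'a retic set)"
    using retic_cases by blast
qed (simp_all add: sup_retic inf_retic retic_le_iff compact_rad_subset_iff)

end

theory Submission
  imports Defs
begin

text \<open>In a semiprime coherent quantale a compact element \<open>c\<close> lies below a minimal prime \<open>p\<close> exactly
  when \<open>annih c\<close> does not.  Hence \<open>Min_Z\<close> is always Hausdorff with a clopen basis, so it is Boolean
  iff it is compact.  The conditions PF, mp, normality of \<open>Spec_F\<close> and conormality of the reticulation
  all say that \<open>sup (annih c) (annih d) = 1\<close> for compact \<open>c\<close>, \<open>d\<close> with \<open>c * d = bot\<close>.  Compactness
  of \<open>Min_Z\<close> provides for each compact \<open>c\<close> a compact \<open>d \<le> annih c\<close> such that no minimal prime
  lies above both; then \<open>annih d \<le> annih (annih c)\<close>, and PF turns into PP.\<close>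

section \<open>Annihilators and compact elements\<close>

lemma mult_bot_right: "a * bot = (bot :: 'a::comm_integral_quantale)"
  using mult_Sup[of a "{}"] by simp

text \<open>Multiplication distributes over the defining join, so \<open>annih a\<close> itself
  annihilates \<open>a\<close>. Almost every later argument about annihilators goes through this
  equivalence.\<close>

lemma le_annih_iff: "x \<le> annih a \<longleftrightarrow> a * x = (bot :: 'a::comm_integral_quantale)"
proof
  assume "x \<le> annih a"
  then have "a * x \<le> a * annih a"
    by (intro mult_mono_quantale order_refl)
  also have "\<dots> = Sup ((*) a ` {x. a * x = bot})"
    by (simp add: annih_def mult_Sup)
  also have "\<dots> = bot"
    by (auto simp: Sup_bot_conv)
  finally show "a * x = bot"
    by (simp add: bot_unique)
qed (auto simp: annih_def intro: Sup_upper)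

lemma mult_annih: "a * annih a = (bot :: 'a::comm_integral_quantale)"
  using le_annih_iff[of "annih a" a] by simp

lemma annih_anti: "a \<le> b \<Longrightarrow> annih b \<le> annih (a :: 'a::comm_integral_quantale)"
  by (metis bot_unique le_annih_iff mult_annih mult_mono_quantale order_refl)

lemma le_annih_annih: "a \<le> annih (annih (a :: 'a::comm_integral_quantale))"
  by (simp add: le_annih_iff mult_annih mult.commute)

lemma le_one: "a \<le> (1 :: 'a::comm_integral_quantale)"
  by (simp add: one_eq_top)

lemma m_primeD:
  assumes "p \<in> Spec"
  shows "\<not> 1 \<le> p" "a * b \<le> p \<Longrightarrow> a \<le> p \<or> b \<le> (p :: 'a::comm_integral_quantale)"
  using assms by (auto simp: Spec_def m_prime_def)

lemma m_prime_power_le: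
  assumes "p \<in> Spec" "a ^ n \<le> p"
  shows "a \<le> (p :: 'a::comm_integral_quantale)"
  using assms(2) by (induction n) (use m_primeD[OF assms(1)] in auto)

lemma m_prime_annih_le:
  assumes "p \<in> Spec" "\<not> a \<le> p"
  shows "annih a \<le> (p :: 'a::comm_integral_quantale)"
  using m_primeD(2)[OF assms(1), of a "annih a"] assms(2) by (simp add: mult_annih)

text \<open>Algebraicity writes \<open>a\<close> as a join of compact elements. Used in
  contrapositive form, the rule extracts a compact element that witnesses a failing
  inequality.\<close>

lemma le_by_compacts:
  assumes "\<And>c. c \<in> compact_elems \<Longrightarrow> c \<le> a \<Longrightarrow> c \<le> b"
  shows "a \<le> (b :: 'a::coherent_quantale)"
  using algebraic[of a] assms by (metis Sup_least Sup_upper subsetD)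

lemma compact_le_Sup_finite:
  assumes "c \<in> compact_elems" "c \<le> Sup S"
  obtains F where "finite F" "F \<subseteq> S" "c \<le> Sup F"
  using assms unfolding compact_elems_def by blast

lemma compact_elems_Sup:
  assumes "finite F" "F \<subseteq> compact_elems"
  shows "Sup F \<in> (compact_elems :: 'a::complete_lattice set)"
  using assms by (induction) (auto simp: compact_elems_bot compact_elems_sup)

text \<open>Since \<open>1\<close> is compact, finitely many compact pieces of \<open>a\<close> and
  \<open>b\<close> already join to it, and sorting them by origin gives \<open>u\<close> and
  \<open>v\<close>. This replaces annihilators, which need not be compact, by compact elements in
  the domain of the reticulation.\<close>

lemma sup_eq_1_compacts:
  assumes "sup a b = (1 :: 'a::coherent_quantale)"
  obtains u v where "u \<in> compact_elems" "v \<in> compact_elems" "u \<le> a" "v \<le> b" "sup u v = 1"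
proof -
  obtain S T where S: "S \<subseteq> compact_elems" "a = Sup S" and T: "T \<subseteq> compact_elems" "b = Sup T"
    by (metis algebraic)
  have "1 \<le> Sup (S \<union> T)"
    using assms S T by (simp add: Sup_union_distrib)
  then obtain F where F: "finite F" "F \<subseteq> S \<union> T" "1 \<le> Sup F"
    using compact_le_Sup_finite[OF one_compact] by blast
  have "Sup F = sup (Sup (F \<inter> S)) (Sup (F \<inter> T))"
    using F(2) by (metis Sup_union_distrib Int_Un_distrib Int_absorb2)
  then have "sup (Sup (F \<inter> S)) (Sup (F \<inter> T)) = 1"
    using F(3) by (metis le_one order_antisym)
  moreover have "Sup (F \<inter> S) \<in> compact_elems" "Sup (F \<inter> T) \<in> compact_elems"
    using S T F by (auto intro!: compact_elems_Sup)
  ultimately show ?thesis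
    using that S T by (metis Sup_subset_mono inf_le2)
qed

section \<open>Existence of primes\<close>

text \<open>An element above \<open>a\<close> that is maximal among those lying above no member of
  \<open>S\<close> is prime. Zorn's lemma applies because the members of \<open>S\<close> are
  compact: one that lies below the join of a chain lies below a member of the chain.\<close>

theorem prime_avoidance:
  fixes a :: "'a::coherent_quantale"
  assumes S: "S \<subseteq> compact_elems" "S \<noteq> {}" "\<And>s t. s \<in> S \<Longrightarrow> t \<in> S \<Longrightarrow> s * t \<in> S"
    and avoid: "\<And>s. s \<in> S \<Longrightarrow> \<not> s \<le> a"
  obtains p where "p \<in> Spec" "a \<le> p" "\<And>s. s \<in> S \<Longrightarrow> \<not> s \<le> p"
proof -
  define X where "X = {x. a \<le> x \<and> (\<forall>s\<in>S. \<not> s \<le> x)}"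
  have "\<exists>m\<in>X. \<forall>x\<in>X. m \<le> x \<longrightarrow> x = m"
  proof (rule predicate_Zorn)
    show "partial_order_on X (relation_of (\<le>) X)"
      by (rule partial_order_on_relation_ofI) auto
    fix C assume "C \<in> Chains (relation_of (\<le>) X)"
    then have C: "C \<subseteq> X" "\<And>x y. x \<in> C \<Longrightarrow> y \<in> C \<Longrightarrow> x \<le> y \<or> y \<le> x"
      by (auto simp: Chains_def relation_of_def)
    show "\<exists>u\<in>X. \<forall>x\<in>C. x \<le> u"
    proof (cases "C = {}")
      case True
      then show ?thesis
        using avoid by (auto simp: X_def)
    next
      case False
      \<comment> \<open>In a chain, a nonempty finite set contains its own join.\<close>
      have fin: "F \<noteq> {} \<Longrightarrow> Sup F \<in> F" if "finite F" "F \<subseteq> C" for F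
        using that
      proof (induction)
        case (insert x F)
        show ?case
        proof (cases "F = {}")
          case False
          then have "Sup F \<in> F"
            using insert by blast
          then have "x \<le> Sup F \<or> Sup F \<le> x"
            using C(2) insert.prems by (meson insert_subset subsetD)
          then show ?thesis
            using \<open>Sup F \<in> F\<close> by (auto simp: sup_absorb1 sup_absorb2)
        qed auto
      qed auto
      have "\<not> s \<le> Sup C" if s: "s \<in> S" for s
      proof
        assume "s \<le> Sup C"
        then obtain F where F: "finite F" "F \<subseteq> C" "s \<le> Sup F"
          using compact_le_Sup_finite S(1) s by (metis subsetD)
        have "\<exists>x\<in>C. s \<le> x"
        proof (cases "F = {}")
          case True
          with F False show ?thesis
            by (metis Sup_empty bot_least ex_in_conv order_trans)
        qed (use F fin in blast)
        then show False
          using C(1) s by (auto simp: X_def)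
      qed
      moreover have "a \<le> Sup C"
        using False C(1) by (auto simp: X_def intro: Sup_upper2)
      ultimately show ?thesis
        by (auto simp: X_def intro: Sup_upper intro!: bexI[of _ "Sup C"])
    qed
  qed
  then obtain p where p: "p \<in> X" "\<And>x. x \<in> X \<Longrightarrow> p \<le> x \<Longrightarrow> x = p"
    by blast
  \<comment> \<open>By maximality, \<open>sup p x\<close> falls outside \<open>X\<close> as soon as
    it is strictly larger than \<open>p\<close>.\<close>
  have meet: "\<exists>s\<in>S. s \<le> sup p x" if "\<not> x \<le> p" for x
    using p(2)[of "sup p x"] p(1) that
    by (auto simp: X_def le_supI1) (metis sup.cobounded2)
  have "m_prime p"
    unfolding m_prime_def
  proof (intro conjI allI impI)
    show "p < 1"
      using S(2) p(1) le_one by (metis (mono_tags, lifting) X_def equals0I mem_Collect_eq order_le_less)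
    fix x y assume xy: "x * y \<le> p"
    show "x \<le> p \<or> y \<le> p"
    proof (rule ccontr)
      assume "\<not> (x \<le> p \<or> y \<le> p)"
      then obtain s t where st: "s \<in> S" "s \<le> sup p x" "t \<in> S" "t \<le> sup p y"
        using meet by metis
      have "s * t \<le> sup p x * sup p y"
        by (intro mult_mono_quantale st)
      \<comment> \<open>In the expansion of the product, every term except \<open>x * y\<close> has
        \<open>p\<close> as a factor.\<close>
      also have "\<dots> \<le> p"
        using xy by (simp add: mult_sup_distrib sup_mult_distrib mult_le_left mult_le_right)
      finally show False
        using S(3)[OF st(1,3)] p(1) by (auto simp: X_def)
    qed
  qed
  then show ?thesis
    using that[of p] p(1) by (auto simp: Spec_def X_def)
qed

lemma prime_above:
  assumes "a \<noteq> (1 :: 'a::coherent_quantale)"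
  obtains p where "p \<in> Spec" "a \<le> p"
proof (rule prime_avoidance[of "{1}" a])
  show "\<not> s \<le> a" if "s \<in> {1}" for s
    using that assms le_one by (metis order_antisym singletonD)
qed (use one_compact that in auto)

text \<open>Zorn's lemma for the reversed order; the point is that the meet of a nonempty chain of
  primes is again prime.\<close>

lemma minimal_prime_below:
  assumes "p \<in> (Spec :: 'a::comm_integral_quantale set)"
  obtains q where "q \<in> Min_Spec" "q \<le> p"
proof -
  define X where "X = {q \<in> Spec. q \<le> p}"
  have "\<exists>m\<in>X. \<forall>x\<in>X. m \<ge> x \<longrightarrow> x = m"
  proof (rule predicate_Zorn)
    show "partial_order_on X (relation_of (\<ge>) X)"
      by (rule partial_order_on_relation_ofI) auto
    fix C assume "C \<in> Chains (relation_of (\<ge>) X)"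
    then have C: "C \<subseteq> X" "\<And>x y. x \<in> C \<Longrightarrow> y \<in> C \<Longrightarrow> x \<le> y \<or> y \<le> x"
      by (auto simp: Chains_def relation_of_def)
    show "\<exists>u\<in>X. \<forall>x\<in>C. x \<ge> u"
    proof (cases "C = {}")
      case True
      then show ?thesis
        using assms by (auto simp: X_def)
    next
      case False
      then obtain r where r: "r \<in> C" by blast
      have "r \<in> X" "Inf C \<le> r"
        using r C(1) by (auto intro: Inf_lower)
      have "m_prime (Inf C)"
        unfolding m_prime_def
      proof (intro conjI allI impI)
        show "Inf C < 1"
          using \<open>Inf C \<le> r\<close> \<open>r \<in> X\<close> by (auto simp: X_def Spec_def m_prime_def)
        fix a b assume ab: "a * b \<le> Inf C"
        show "a \<le> Inf C \<or> b \<le> Inf C"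
        proof (rule ccontr)
          assume "\<not> (a \<le> Inf C \<or> b \<le> Inf C)"
          then obtain x y where xy: "x \<in> C" "\<not> a \<le> x" "y \<in> C" "\<not> b \<le> y"
            by (auto simp: le_Inf_iff)
          \<comment> \<open>\<open>z\<close> is the smaller of \<open>x\<close> and
            \<open>y\<close>; it lies above neither \<open>a\<close> nor \<open>b\<close>.\<close>
          then obtain z where z: "z \<in> C" "\<not> a \<le> z" "\<not> b \<le> z"
            using C(2) order_trans by metis
          then have "z \<in> Spec" "a * b \<le> z"
            using ab C(1) by (auto simp: X_def intro: Inf_lower2 order_trans[OF ab])
          then show False
            using m_primeD(2) z by blast
        qed
      qed
      then show ?thesis
        using \<open>Inf C \<le> r\<close> \<open>r \<in> X\<close>
        by (auto simp: X_def Spec_def intro: Inf_lower intro!: bexI[of _ "Inf C"])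
    qed
  qed
  then obtain q where q: "q \<in> X" "\<And>x. x \<in> X \<Longrightarrow> x \<le> q \<Longrightarrow> x = q"
    by blast
  then have "q \<in> Min_Spec"
    by (auto simp: Min_Spec_def X_def)
  then show ?thesis
    using that q(1) by (auto simp: X_def)
qed

section \<open>Minimal primes of a semiprime coherent quantale\<close>

lemma Min_Spec_subset: "Min_Spec \<subseteq> Spec"
  by (auto simp: Min_Spec_def)

lemma semiprime_power_eq_bot:
  assumes "semiprime_quantale TYPE('a::comm_integral_quantale)" "(a :: 'a) ^ n = bot"
  shows "a = bot"
proof -
  have "a \<le> Inf Spec"
    using m_prime_power_le[of _ a n] assms(2) by (auto intro!: Inf_greatest)
  then show ?thesis
    using assms(1) by (simp add: semiprime_quantale_def bot_unique)
qed

text \<open>For positive \<open>n\<close>, \<open>(a * b) ^ n\<close> is a multiple of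
  \<open>a * b ^ n\<close>, hence zero, and semiprimeness excludes nonzero nilpotent
  elements.\<close>

lemma semiprime_mult_power_eq_bot:
  assumes sp: "semiprime_quantale TYPE('a::comm_integral_quantale)" and "(a :: 'a) * b ^ n = bot"
  shows "a * b = bot"
proof (cases "n = 0")
  case True
  then show ?thesis
    using assms(2) mult_bot_right[of b] by (simp add: mult.commute)
next
  case False
  then have "(a * b) ^ n = a ^ (n - 1) * (a * b ^ n)"
    by (cases n) (simp_all add: power_mult_distrib ac_simps)
  then show ?thesis
    using semiprime_power_eq_bot[OF sp, of "a * b" n] by (simp add: assms(2) mult_bot_right)
qed

text \<open>Prime avoidance is applied to the products of powers of \<open>c\<close> with compact
  elements not below \<open>p\<close>. The product \<open>bot\<close> cannot occur: by semiprimeness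
  it would put such a factor below \<open>annih c\<close>, hence below \<open>p\<close>.\<close>

lemma exists_minimal_prime_avoiding:
  fixes p :: "'a::coherent_quantale"
  assumes sp: "semiprime_quantale TYPE('a)"
    and p: "p \<in> Spec" and c: "c \<in> compact_elems" "annih c \<le> p"
  obtains q where "q \<in> Min_Spec" "q \<le> p" "\<not> c \<le> q"
proof -
  \<comment> \<open>The exponent \<open>n = 0\<close> is allowed on purpose: it puts into
    \<open>S\<close> every compact element not below \<open>p\<close>, which forces
    \<open>r \<le> p\<close>. Taking \<open>d = 1\<close> and \<open>n = 1\<close> puts in
    \<open>c\<close> itself.\<close>
  define S where "S = {d * c ^ n |d n. d \<in> compact_elems \<and> \<not> d \<le> p}"
  have pow: "c ^ n \<in> compact_elems" for n
    by (induction n) (auto simp: one_compact mult_compact c)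
  obtain r where r: "r \<in> Spec" "\<And>s. s \<in> S \<Longrightarrow> \<not> s \<le> r"
  proof (rule prime_avoidance[of S bot])
    show "S \<subseteq> compact_elems"
      by (auto simp: S_def mult_compact pow)
    show "S \<noteq> {}"
      using one_compact m_primeD(1)[OF p] by (auto simp: S_def)
    show "s * t \<in> S" if st: "s \<in> S" "t \<in> S" for s t
    proof -
      obtain d n e m where "s = d * c ^ n" "t = e * c ^ m" "d \<in> compact_elems" "\<not> d \<le> p"
        "e \<in> compact_elems" "\<not> e \<le> p"
        using st unfolding S_def by blast
      moreover from this have "s * t = (d * e) * c ^ (n + m)"
        by (simp add: power_add ac_simps)
      ultimately show ?thesis
        using m_primeD(2)[OF p] mult_compact unfolding S_def by blast
    qed
    show "\<not> s \<le> bot" if "s \<in> S" for s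
    proof
      assume "s \<le> bot"
      with \<open>s \<in> S\<close> obtain d n where d: "d * c ^ n = bot" "\<not> d \<le> p"
        unfolding S_def bot_unique by blast
      then have "d \<le> annih c"
        using semiprime_mult_power_eq_bot[OF sp, of d c n] by (simp add: le_annih_iff mult.commute)
      then show False
        using d c(2) by (meson order_trans)
    qed
  qed blast
  have "r \<le> p"
  proof (rule le_by_compacts)
    fix d assume "d \<in> compact_elems" "d \<le> r"
    then show "d \<le> p"
      using r(2)[of "d * c ^ 0"] unfolding S_def by (metis (mono_tags, lifting) CollectI mult.right_neutral power_0)
  qed
  moreover have "\<not> c \<le> r"
    using r(2)[of "1 * c ^ 1"] one_compact m_primeD(1)[OF p] unfolding S_def
    by (metis (mono_tags, lifting) CollectI mult_1 power_one_right)
  moreover obtain q where "q \<in> Min_Spec" "q \<le> r"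
    using minimal_prime_below[OF r(1)] by blast
  ultimately show ?thesis
    using that by (meson order_trans)
qed

text \<open>If \<open>c\<close> and \<open>annih c\<close> were both below \<open>p\<close>, the
  preceding lemma would give a minimal prime below \<open>p\<close> but not above \<open>c\<close>,
  contradicting minimality. If neither were, primeness would fail at
  \<open>c * annih c = bot\<close>.\<close>

lemma minimal_prime_le_iff:
  fixes p :: "'a::coherent_quantale"
  assumes sp: "semiprime_quantale TYPE('a)" and p: "p \<in> Min_Spec" and c: "c \<in> compact_elems"
  shows "c \<le> p \<longleftrightarrow> \<not> annih c \<le> p"
proof
  have "p \<in> Spec"
    using p by (simp add: Min_Spec_def)
  show "\<not> annih c \<le> p" if "c \<le> p"
  proof
    assume "annih c \<le> p"
    then obtain q where "q \<in> Min_Spec" "q \<le> p" "\<not> c \<le> q"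
      using exists_minimal_prime_avoiding[OF sp \<open>p \<in> Spec\<close> c] by blast
    with p that show False
      by (auto simp: Min_Spec_def)
  qed
  show "c \<le> p" if "\<not> annih c \<le> p"
    using that m_prime_annih_le[OF \<open>p \<in> Spec\<close>] by blast
qed

lemma eq_bot_by_minimal_primes:
  assumes sp: "semiprime_quantale TYPE('a::comm_integral_quantale)"
    and "\<And>p. p \<in> Min_Spec \<Longrightarrow> (a :: 'a) \<le> p"
  shows "a = bot"
proof -
  have "a \<le> Inf Spec"
    by (intro Inf_greatest) (metis assms(2) minimal_prime_below order_trans)
  then show ?thesis
    using sp by (simp add: semiprime_quantale_def bot_unique)
qed

section \<open>The space of minimal primes\<close>

lemma openin_Min_Z: "openin Min_Z U \<longleftrightarrow> (\<exists>a. U = {p \<in> Min_Spec. \<not> a \<le> p})"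
proof -
  have eq: "(Spec - V a) \<inter> Min_Spec = {p \<in> Min_Spec. \<not> a \<le> p}" for a :: 'a
    using Min_Spec_subset by (auto simp: V_def)
  show ?thesis
    unfolding Min_Z_def openin_subtopology openin_Spec_Z by (metis eq)
qed

lemma topspace_Min_Z: "topspace Min_Z = (Min_Spec :: 'a::comm_integral_quantale set)"
  unfolding Min_Z_def topspace_subtopology topspace_Spec_Z using Min_Spec_subset by auto

lemma openin_Min_Z_basic: "openin Min_Z {p \<in> Min_Spec. \<not> a \<le> p}"
  using openin_Min_Z by blast

text \<open>Distinct minimal primes are incomparable, so some compact \<open>c\<close> lies below
  one and not the other. The basic open sets of \<open>c\<close> and \<open>annih c\<close> then
  separate them.\<close>

lemma Hausdorff_space_Min_Z:
  assumes sp: "semiprime_quantale TYPE('a::coherent_quantale)"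
  shows "Hausdorff_space (Min_Z :: 'a topology)"
  unfolding Hausdorff_space_def topspace_Min_Z
proof (intro allI impI, elim conjE)
  fix p q :: 'a assume pq: "p \<in> Min_Spec" "q \<in> Min_Spec" "p \<noteq> q"
  have "\<not> p \<le> q"
    using pq by (auto simp: Min_Spec_def)
  then obtain c where c: "c \<in> compact_elems" "c \<le> p" "\<not> c \<le> q"
    using le_by_compacts by blast
  show "\<exists>U V. openin Min_Z U \<and> openin Min_Z V \<and> p \<in> U \<and> q \<in> V \<and> disjnt U V"
    using openin_Min_Z_basic minimal_prime_le_iff[OF sp _ c(1)] c pq
    by (intro exI[of _ "{p \<in> Min_Spec. \<not> annih c \<le> p}"] exI[of _ "{p \<in> Min_Spec. \<not> c \<le> p}"])
      (auto simp: disjnt_def)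
qed

lemma Boolean_space_Min_Z_iff:
  assumes sp: "semiprime_quantale TYPE('a::coherent_quantale)"
  shows "Boolean_space (Min_Z :: 'a topology) \<longleftrightarrow> compact_space (Min_Z :: 'a topology)"
proof -
  define \<B> where "\<B> = (\<lambda>c::'a. {p \<in> Min_Spec. \<not> c \<le> p}) ` compact_elems"
  have "closedin Min_Z {p \<in> Min_Spec. \<not> c \<le> p}" if "c \<in> compact_elems" for c :: 'a
  proof -
    \<comment> \<open>The complement of a basic open set is the basic open set of the annihilator,
      which makes the base clopen.\<close>
    have "Min_Spec - {p \<in> Min_Spec. \<not> c \<le> p} = {p \<in> Min_Spec. \<not> annih c \<le> p}"
      using minimal_prime_le_iff[OF sp _ that] by auto
    then show ?thesis
      by (auto simp: closedin_def topspace_Min_Z openin_Min_Z_basic)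
  qed
  then have clopen: "\<forall>B\<in>\<B>. openin Min_Z B \<and> closedin Min_Z B"
    by (auto simp: \<B>_def openin_Min_Z_basic)
  have base: "openin Min_Z = arbitrary union_of (\<lambda>B. B \<in> \<B>)"
    unfolding openin_topology_base_unique
  proof (intro conjI allI impI)
    fix U and p :: 'a assume U: "openin Min_Z U \<and> p \<in> U"
    then obtain a where a: "U = {p \<in> Min_Spec. \<not> a \<le> p}"
      by (auto simp: openin_Min_Z)
    with U obtain c where c: "c \<in> compact_elems" "c \<le> a" "\<not> c \<le> p"
      using le_by_compacts by blast
    show "\<exists>B. B \<in> \<B> \<and> p \<in> B \<and> B \<subseteq> U"
      using c U by (intro exI[of _ "{p \<in> Min_Spec. \<not> c \<le> p}"]) (auto simp: \<B>_def a)
  qed (use clopen in blast)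
  have "\<exists>\<B>. (\<forall>B\<in>\<B>. openin (Min_Z :: 'a topology) B \<and> closedin Min_Z B) \<and>
      openin Min_Z = arbitrary union_of (\<lambda>B. B \<in> \<B>)"
    using clopen base by (intro exI[of _ \<B>] conjI)
  then show ?thesis
    unfolding Boolean_space_def using Hausdorff_space_Min_Z[OF sp] by blast
qed

text \<open>The open set of \<open>Sup S\<close> is the union of the open sets of the members of
  \<open>S\<close>. An open cover therefore amounts to a set \<open>S\<close> whose join lies below
  no minimal prime.\<close>

lemma compact_space_Min_Z_iff:
  "compact_space (Min_Z :: 'a::comm_integral_quantale topology) \<longleftrightarrow>
    (\<forall>S :: 'a set. (\<forall>p\<in>Min_Spec. \<not> Sup S \<le> p) \<longrightarrow>
      (\<exists>F. finite F \<and> F \<subseteq> S \<and> (\<forall>p\<in>Min_Spec. \<not> Sup F \<le> p)))" (is "?L \<longleftrightarrow> ?R")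
proof
  assume L: ?L
  show ?R
  proof (intro allI impI)
    fix S :: "'a set" assume S: "\<forall>p\<in>Min_Spec. \<not> Sup S \<le> p"
    have "Min_Spec \<subseteq> (\<Union>s\<in>S. {p \<in> Min_Spec. \<not> s \<le> p})"
      using S by (auto simp: Sup_le_iff)
    moreover have "\<forall>U\<in>(\<lambda>s. {p \<in> Min_Spec. \<not> s \<le> p}) ` S. openin Min_Z U"
      using openin_Min_Z_basic by blast
    ultimately obtain \<F> where \<F>: "finite \<F>" "\<F> \<subseteq> (\<lambda>s. {p \<in> Min_Spec. \<not> s \<le> p}) ` S"
      "Min_Spec \<subseteq> \<Union>\<F>"
      using L unfolding compact_space_alt topspace_Min_Z by meson
    obtain F where "finite F" "F \<subseteq> S" "\<F> = (\<lambda>s. {p \<in> Min_Spec. \<not> s \<le> p}) ` F"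
      using finite_subset_image[OF \<F>(1,2)] by blast
    with \<F>(3) show "\<exists>F. finite F \<and> F \<subseteq> S \<and> (\<forall>p\<in>Min_Spec. \<not> Sup F \<le> p)"
      by (intro exI[of _ F]) (auto simp: Sup_le_iff)
  qed
next
  assume R: ?R
  show ?L
    unfolding compact_space_alt topspace_Min_Z
  proof (intro allI impI, elim conjE)
    fix \<U> :: "'a set set" assume \<U>: "\<forall>U\<in>\<U>. openin Min_Z U" "Min_Spec \<subseteq> \<Union>\<U>"
    obtain f where f: "\<And>U. U \<in> \<U> \<Longrightarrow> U = {p \<in> Min_Spec. \<not> f U \<le> p}"
      using \<U>(1) unfolding openin_Min_Z by metis
    have "\<not> Sup (f ` \<U>) \<le> p" if "p \<in> Min_Spec" for p
      using \<U>(2) that f unfolding Sup_le_iff by blast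
    then obtain F where F: "finite F" "F \<subseteq> f ` \<U>" "\<forall>p\<in>Min_Spec. \<not> Sup F \<le> p"
      using R by meson
    obtain \<F> where \<F>: "finite \<F>" "\<F> \<subseteq> \<U>" "F = f ` \<F>"
      using finite_subset_image[OF F(1,2)] by blast
    have "Min_Spec \<subseteq> \<Union>\<F>"
      using F(3) \<F> f unfolding Sup_le_iff by blast
    with \<F> show "\<exists>\<F>. finite \<F> \<and> \<F> \<subseteq> \<U> \<and> Min_Spec \<subseteq> \<Union>\<F>"
      by blast
  qed
qed

section \<open>PP, PF and mp quantales\<close>

text \<open>The compact elements \<open>d\<close> tested by purity of \<open>annih c\<close> are
  those with \<open>c * d = bot\<close>. The resulting condition is symmetric in \<open>c\<close>
  and \<open>d\<close> and is the quantale form of conormality.\<close>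

lemma PF_quantale_iff:
  "PF_quantale TYPE('a::comm_integral_quantale) \<longleftrightarrow>
    (\<forall>c\<in>(compact_elems :: 'a set). \<forall>d\<in>compact_elems. c * d = bot \<longrightarrow> sup (annih c) (annih d) = 1)"
  by (auto simp: PF_quantale_def pure_def le_annih_iff)

text \<open>If \<open>c * d = bot\<close>, then \<open>d \<le> annih c\<close>, so
  \<open>annih d\<close> lies above \<open>annih (annih c)\<close>, which together with
  \<open>annih c\<close> joins to \<open>1\<close>.\<close>

lemma PP_imp_PF:
  assumes "PP_quantale TYPE('a::comm_integral_quantale)"
  shows "PF_quantale TYPE('a)"
  unfolding PF_quantale_iff
proof (intro ballI impI)
  fix c d :: 'a assume cd: "c \<in> compact_elems" "c * d = bot"
  have "sup (annih c) (annih (annih c)) = 1"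
    using assms cd(1) by (auto simp: PP_quantale_def complemented_elems_def)
  moreover have "annih (annih c) \<le> annih d"
    using cd by (intro annih_anti) (simp add: le_annih_iff)
  ultimately show "sup (annih c) (annih d) = 1"
    by (metis le_one order_antisym order_refl sup_mono)
qed

text \<open>The join of all \<open>annih (annih c)\<close> with \<open>c\<close> compact below \<open>Sup S\<close> is \<open>1\<close>, since a prime
  above it would have a minimal prime below it that lies above \<open>Sup S\<close>.\<close>

lemma PP_imp_compact_Min_Z:
  assumes sp: "semiprime_quantale TYPE('a::coherent_quantale)" and PP: "PP_quantale TYPE('a)"
  shows "compact_space (Min_Z :: 'a topology)"
  unfolding compact_space_Min_Z_iff
proof (intro allI impI)
  fix S :: "'a set" assume S: "\<forall>p\<in>Min_Spec. \<not> Sup S \<le> p"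
  define C where "C = {c \<in> compact_elems. c \<le> Sup S}"
  have "Sup ((\<lambda>c. annih (annih c)) ` C) = 1"
  proof (rule ccontr)
    assume "Sup ((\<lambda>c. annih (annih c)) ` C) \<noteq> 1"
    then obtain p where p: "p \<in> Spec" "Sup ((\<lambda>c. annih (annih c)) ` C) \<le> p"
      using prime_above by blast
    obtain q where q: "q \<in> Min_Spec" "q \<le> p"
      using minimal_prime_below[OF p(1)] by blast
    have "Sup S \<le> q"
    proof (rule le_by_compacts)
      fix c assume c: "c \<in> compact_elems" "c \<le> Sup S"
      then have "annih (annih c) \<le> p"
        using p(2) by (auto simp: Sup_le_iff C_def)
      moreover have "sup (annih c) (annih (annih c)) = 1"
        using PP c(1) by (auto simp: PP_quantale_def complemented_elems_def)
      ultimately have "\<not> annih c \<le> p"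
        using m_primeD(1)[OF p(1)] by (metis le_sup_iff)
      then have "\<not> annih c \<le> q"
        using q(2) by (meson order_trans)
      then show "c \<le> q"
        using minimal_prime_le_iff[OF sp q(1) c(1)] by blast
    qed
    then show False
      using S q(1) by blast
  qed
  then obtain G where G: "finite G" "G \<subseteq> C" "1 \<le> Sup ((\<lambda>c. annih (annih c)) ` G)"
    using compact_le_Sup_finite[OF one_compact, of "(\<lambda>c. annih (annih c)) ` C"]
    by (metis finite_subset_image order_refl)
  have SG: "Sup G \<in> compact_elems" "Sup G \<le> Sup S"
    using G by (auto simp: C_def intro!: compact_elems_Sup Sup_least)
  \<comment> \<open>Double annihilation is monotone, so the finitely many elements of
    \<open>G\<close> can be merged into their join. Its annihilator then vanishes and so lies below
    every minimal prime, hence \<open>Sup G\<close> lies below none.\<close>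
  have "Sup ((\<lambda>c. annih (annih c)) ` G) \<le> annih (annih (Sup G))"
    by (intro SUP_least annih_anti Sup_upper)
  then have "annih (annih (Sup G)) = 1"
    using G(3) by (metis le_one order_antisym)
  then have "annih (Sup G) = bot"
    using mult_annih[of "annih (Sup G)"] by simp
  then have *: "\<not> Sup G \<le> p" if "p \<in> Min_Spec" for p
    using minimal_prime_le_iff[OF sp that SG(1)] by simp
  obtain F where "finite F" "F \<subseteq> S" "Sup G \<le> Sup F"
    using compact_le_Sup_finite[OF SG] by blast
  then show "\<exists>F. finite F \<and> F \<subseteq> S \<and> (\<forall>p\<in>Min_Spec. \<not> Sup F \<le> p)"
    using * by (meson order_trans)
qed

lemma PF_compact_imp_PP:
  assumes sp: "semiprime_quantale TYPE('a::coherent_quantale)" and PF: "PF_quantale TYPE('a)"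
    and comp: "compact_space (Min_Z :: 'a topology)"
  shows "PP_quantale TYPE('a)"
  unfolding PP_quantale_def complemented_elems_def
proof (intro ballI CollectI)
  fix c :: 'a assume c: "c \<in> compact_elems"
  \<comment> \<open>The compact elements below \<open>annih c\<close>. Their join is
    \<open>annih c\<close>, so together with \<open>c\<close> they leave no minimal prime
    uncovered.\<close>
  define S where "S = {d \<in> compact_elems. c * d = bot}"
  have "\<not> Sup (insert c S) \<le> p" if "p \<in> Min_Spec" for p
  proof
    assume le: "Sup (insert c S) \<le> p"
    have "annih c \<le> p"
      using le by - (rule le_by_compacts, auto simp: S_def le_annih_iff Sup_le_iff)
    moreover have "c \<le> p"
      using le by simp
    ultimately show False
      using minimal_prime_le_iff[OF sp that c] by blast
  qed
  then obtain F where F: "finite F" "F \<subseteq> insert c S" "\<forall>p\<in>Min_Spec. \<not> Sup F \<le> p"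
    using comp unfolding compact_space_Min_Z_iff by meson
  \<comment> \<open>The finite subcover may contain \<open>c\<close>; without it only members of
    \<open>S\<close> remain, which keeps \<open>d\<close> below \<open>annih c\<close>.\<close>
  define d where "d = Sup (F - {c})"
  have d: "d \<in> compact_elems" "d \<le> annih c"
    using F(1,2) unfolding d_def
    by (auto simp: S_def simp flip: le_annih_iff intro!: compact_elems_Sup Sup_least)
  have "Sup F \<le> sup c d"
    unfolding d_def by (rule Sup_least) (metis Diff_iff Sup_upper insert_iff le_supI1 le_supI2 order_refl empty_iff)
  then have cd: "\<not> c \<le> p \<or> \<not> d \<le> p" if "p \<in> Min_Spec" for p
    using F(3) that by (meson le_sup_iff order_trans)
  have "sup (annih c) (annih d) = 1"
    using PF c d unfolding PF_quantale_iff by (simp add: le_annih_iff)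
  \<comment> \<open>Each minimal prime misses \<open>c\<close> or \<open>d\<close> and therefore
    lies above \<open>annih c\<close> or \<open>annih d\<close>, so the product of the two
    annihilators lies below all minimal primes.\<close>
  moreover have "annih d \<le> annih (annih c)"
    unfolding le_annih_iff
  proof (rule eq_bot_by_minimal_primes[OF sp])
    fix p :: 'a assume p: "p \<in> Min_Spec"
    then have "annih c \<le> p \<or> annih d \<le> p"
      using cd m_prime_annih_le Min_Spec_subset by blast
    then show "annih c * annih d \<le> p"
      by (meson mult_le_left mult_le_right order_trans)
  qed
  ultimately show "sup (annih c) (annih (annih c)) = 1"
    by (metis le_one order_antisym order_refl sup_mono)
qed

text \<open>Under PF, two different minimal primes below \<open>p\<close> would produce compact
  \<open>c\<close> and \<open>d\<close> with \<open>c * d = bot\<close> and both annihilators below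
  \<open>p\<close>, although these join to \<open>1\<close>. Conversely, a prime above both
  annihilators would have a minimal prime below it missing \<open>c\<close> and another missing
  \<open>d\<close>; uniqueness identifies them, against \<open>c * d = bot\<close>.\<close>

lemma PF_iff_mp:
  assumes sp: "semiprime_quantale TYPE('a::coherent_quantale)"
  shows "PF_quantale TYPE('a) \<longleftrightarrow> mp_quantale TYPE('a)"
proof
  assume PF: "PF_quantale TYPE('a)"
  have le: "q \<le> r" if "p \<in> Spec" "q \<in> Min_Spec" "q \<le> p" "r \<in> Min_Spec" "r \<le> p" for p q r :: 'a
  proof (rule le_by_compacts, rule ccontr)
    fix c assume c: "c \<in> compact_elems" "c \<le> q" "\<not> c \<le> r"
    then have "\<not> annih c \<le> q"
      using minimal_prime_le_iff[OF sp that(2)] by blast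
    then obtain d where d: "d \<in> compact_elems" "d \<le> annih c" "\<not> d \<le> q"
      using le_by_compacts by blast
    have "sup (annih c) (annih d) = 1"
      using PF c d unfolding PF_quantale_iff by (simp add: le_annih_iff)
    moreover have "annih c \<le> p" "annih d \<le> p"
      using that c d m_prime_annih_le Min_Spec_subset by (meson order_trans subsetD)+
    ultimately show False
      using m_primeD(1)[OF that(1)] by (metis le_sup_iff)
  qed
  show "mp_quantale TYPE('a)"
    unfolding mp_quantale_def
  proof (intro ballI)
    fix p :: 'a assume p: "p \<in> Spec"
    obtain q where q: "q \<in> Min_Spec" "q \<le> p"
      using minimal_prime_below[OF p] by blast
    then show "\<exists>!q. q \<in> Min_Spec \<and> q \<le> p"
      using le[OF p] by (intro ex1I[of _ q]) (auto intro: order_antisym)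
  qed
next
  assume mp: "mp_quantale TYPE('a)"
  show "PF_quantale TYPE('a)"
    unfolding PF_quantale_iff
  proof (intro ballI impI, rule ccontr)
    fix c d :: 'a
    assume cd: "c \<in> compact_elems" "d \<in> compact_elems" "c * d = bot"
      and "sup (annih c) (annih d) \<noteq> 1"
    then obtain p where p: "p \<in> Spec" "annih c \<le> p" "annih d \<le> p"
      using prime_above by (metis le_sup_iff)
    obtain q r where "q \<in> Min_Spec" "q \<le> p" "\<not> c \<le> q" "r \<in> Min_Spec" "r \<le> p" "\<not> d \<le> r"
      using exists_minimal_prime_avoiding[OF sp p(1)] cd p by metis
    moreover from this have "q = r"
      using mp p(1) unfolding mp_quantale_def by blast
    ultimately show False
      using m_primeD(2)[of q c d] cd(3) Min_Spec_subset by auto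
  qed
qed

section \<open>The flat topology\<close>

lemma openin_Spec_F_iff:
  "openin Spec_F U \<longleftrightarrow> (\<forall>p\<in>U. \<exists>c\<in>compact_elems. p \<in> V c \<and> V c \<subseteq> U)"
  unfolding openin_Spec_F arbitrary_union_of_alt by blast

lemma openin_Spec_F_V: "c \<in> compact_elems \<Longrightarrow> openin Spec_F (V c)"
  unfolding openin_Spec_F_iff by blast

text \<open>Each basic set \<open>V c\<close> is closed under passing to larger primes.\<close>

lemma openin_Spec_F_upward:
  assumes "openin Spec_F U" "q \<in> U" "q \<le> p" "p \<in> Spec"
  shows "p \<in> U"
  using assms unfolding openin_Spec_F_iff V_def by (metis (mono_tags, lifting) mem_Collect_eq order_trans subsetD)

lemma closedin_Spec_F_minimal:
  assumes "q \<in> (Min_Spec :: 'a::coherent_quantale set)"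
  shows "closedin Spec_F {q}"
  unfolding closedin_def topspace_Spec_F openin_Spec_F_iff
proof (intro conjI ballI)
  show "{q} \<subseteq> Spec"
    using assms Min_Spec_subset by blast
  fix p assume p: "p \<in> Spec - {q}"
  then have "\<not> p \<le> q"
    using assms by (auto simp: Min_Spec_def)
  then obtain c where "c \<in> compact_elems" "c \<le> p" "\<not> c \<le> q"
    using le_by_compacts by blast
  then show "\<exists>c\<in>compact_elems. p \<in> V c \<and> V c \<subseteq> Spec - {q}"
    using p by (auto simp: V_def)
qed

text \<open>Minimal primes are closed points in the flat topology. Two of them below the same
  \<open>p\<close> cannot be separated, since every open set containing either one contains
  \<open>p\<close>.\<close>

lemma normal_Spec_F_imp_mp:
  assumes "normal_space (Spec_F :: 'a::coherent_quantale topology)"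
  shows "mp_quantale TYPE('a)"
  unfolding mp_quantale_def
proof (intro ballI)
  fix p :: 'a assume p: "p \<in> Spec"
  obtain q where q: "q \<in> Min_Spec" "q \<le> p"
    using minimal_prime_below[OF p] by blast
  have "r = q" if r: "r \<in> Min_Spec" "r \<le> p" for r
  proof (rule ccontr)
    assume "r \<noteq> q"
    then obtain U W where "openin Spec_F U" "openin Spec_F W" "{r} \<subseteq> U" "{q} \<subseteq> W" "disjnt U W"
      using assms closedin_Spec_F_minimal[OF q(1)] closedin_Spec_F_minimal[OF r(1)]
      unfolding normal_space_def by (metis disjnt_insert1 disjnt_empty1 singletonD)
    then show False
      using openin_Spec_F_upward[OF _ _ q(2) p] openin_Spec_F_upward[OF _ _ r(2) p]
      by (auto simp: disjnt_def)
  qed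
  then show "\<exists>!q. q \<in> Min_Spec \<and> q \<le> p"
    using q by blast
qed

text \<open>Prime avoidance reduces the separation of two closed sets to two compact elements with
  product \<open>bot\<close>, to which PF applies.\<close>

lemma PF_imp_normal_Spec_F:
  assumes sp: "semiprime_quantale TYPE('a::coherent_quantale)" and PF: "PF_quantale TYPE('a)"
  shows "normal_space (Spec_F :: 'a topology)"
  unfolding normal_space_def
proof (intro allI impI, elim conjE)
  fix G H :: "'a set" assume cl: "closedin Spec_F G" "closedin Spec_F H" and "disjnt G H"
  define C where "C G = {c \<in> compact_elems. V c \<inter> G = {}}" for G :: "'a set"
  have mult: "c * d \<in> C G" if "c \<in> C G" "d \<in> C G" for c d G
    using that by (auto simp: C_def V_mult mult_compact)
  have one: "1 \<in> C G" for G
    using m_primeD(1) by (auto simp: C_def V_def one_compact)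
  \<comment> \<open>A closed set is recovered from the basic open sets that miss it.\<close>
  have mem: "p \<in> G" if G: "closedin Spec_F G" "p \<in> Spec" "\<And>c. c \<in> C G \<Longrightarrow> \<not> c \<le> p" for p G
  proof (rule ccontr)
    assume "p \<notin> G"
    then obtain c where "c \<in> compact_elems" "p \<in> V c" "V c \<subseteq> Spec - G"
      using G(1,2) \<open>p \<notin> G\<close> unfolding closedin_def topspace_Spec_F openin_Spec_F_iff by blast
    then show False
      using G(3)[of c] by (auto simp: C_def V_def)
  qed
  define S where "S = {c * d |c d. c \<in> C G \<and> d \<in> C H}"
  \<comment> \<open>Otherwise some prime avoids \<open>S\<close>. As \<open>1\<close> belongs to
    both \<open>C G\<close> and \<open>C H\<close>, this prime avoids each of these sets as well and
    so lies in \<open>G\<close> and in \<open>H\<close>.\<close>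
  have "bot \<in> S"
  proof (rule ccontr)
    assume "bot \<notin> S"
    obtain p where p: "p \<in> Spec" "\<And>s. s \<in> S \<Longrightarrow> \<not> s \<le> p"
    proof (rule prime_avoidance[of S bot])
      show "S \<subseteq> compact_elems"
        by (auto simp: S_def C_def mult_compact)
      show "S \<noteq> {}"
        using one by (auto simp: S_def)
      show "s * t \<in> S" if st: "s \<in> S" "t \<in> S" for s t
      proof -
        obtain c d c' d' where "s = c * d" "t = c' * d'" "c \<in> C G" "d \<in> C H" "c' \<in> C G" "d' \<in> C H"
          using st unfolding S_def by blast
        moreover from this have "s * t = (c * c') * (d * d')"
          by (simp add: ac_simps)
        ultimately show ?thesis
          using mult unfolding S_def by blast
      qed
      show "\<not> s \<le> bot" if "s \<in> S" for s
        using that \<open>bot \<notin> S\<close> by (auto simp: bot_unique)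
    qed blast
    have "p \<in> G"
      using p(2) one[of H] by (intro mem[OF cl(1) p(1)]) (force simp: S_def)
    moreover have "p \<in> H"
      using p(2) one[of G] by (intro mem[OF cl(2) p(1)]) (force simp: S_def)
    ultimately show False
      using \<open>disjnt G H\<close> by (auto simp: disjnt_def)
  qed
  then obtain c d where cd: "c \<in> C G" "d \<in> C H" "c * d = bot"
    by (auto simp: S_def)
  then have "sup (annih c) (annih d) = 1"
    using PF by (auto simp: PF_quantale_iff C_def)
  then obtain u v where uv: "u \<in> compact_elems" "v \<in> compact_elems" "u \<le> annih c" "v \<le> annih d"
    "sup u v = 1"
    by (rule sup_eq_1_compacts)
  have "disjnt (V u) (V v)"
    using uv(5) m_primeD(1) by (force simp: disjnt_def V_def simp flip: uv(5))
  \<comment> \<open>A prime in \<open>G\<close> is not above \<open>c\<close>, so it lies above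
    \<open>annih c\<close> and hence above \<open>u\<close>.\<close>
  moreover have "G \<subseteq> V u"
    using cd(1) uv(3) closedin_subset[OF cl(1)] m_prime_annih_le[of _ c]
    by (auto simp: V_def C_def topspace_Spec_F intro: order_trans)
  moreover have "H \<subseteq> V v"
    using cd(2) uv(4) closedin_subset[OF cl(2)] m_prime_annih_le[of _ d]
    by (auto simp: V_def C_def topspace_Spec_F intro: order_trans)
  ultimately show "\<exists>U W. openin Spec_F U \<and> openin Spec_F W \<and> G \<subseteq> U \<and> H \<subseteq> W \<and> disjnt U W"
    using uv openin_Spec_F_V by blast
qed

section \<open>The reticulation\<close>

context
  fixes lam :: "'a::coherent_quantale \<Rightarrow> 'l::{bounded_lattice,distrib_lattice}"
  assumes ret: "reticulation lam"
begin

section \<open>Elementary rules for the reticulation map\<close>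

lemma lam_cases:
  obtains c where "c \<in> compact_elems" "x = lam c"
  using ret unfolding reticulation_def by blast

lemma lam_le_iff:
  "a \<in> compact_elems \<Longrightarrow> b \<in> compact_elems \<Longrightarrow> lam a \<le> lam b \<longleftrightarrow> (\<exists>n\<ge>1. a ^ n \<le> b)"
  using ret unfolding reticulation_def by blast

lemma lam_mult:
  "a \<in> compact_elems \<Longrightarrow> b \<in> compact_elems \<Longrightarrow> lam (a * b) = inf (lam a) (lam b)"
  using ret unfolding reticulation_def by blast

lemma lam_mono: "a \<in> compact_elems \<Longrightarrow> b \<in> compact_elems \<Longrightarrow> a \<le> b \<Longrightarrow> lam a \<le> lam b"
  unfolding lam_le_iff by (rule exI[of _ 1]) simp

lemma lam_sup:
  assumes "a \<in> compact_elems" "b \<in> compact_elems"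
  shows "lam (sup a b) = sup (lam a) (lam b)"
proof (rule order_antisym)
  show "lam (sup a b) \<le> sup (lam a) (lam b)"
    using ret assms unfolding reticulation_def by blast
qed (use assms in \<open>auto intro!: lam_mono compact_elems_sup\<close>)

lemma lam_bot: "lam bot = bot"
proof -
  obtain c where "c \<in> compact_elems" "bot = lam c"
    using lam_cases by blast
  then show ?thesis
    using lam_mono[OF compact_elems_bot, of c] by (simp add: bot_unique)
qed

lemma lam_one: "lam 1 = top"
proof -
  obtain c where "c \<in> compact_elems" "top = lam c"
    using lam_cases by blast
  then show ?thesis
    using lam_mono[OF _ one_compact, of c] by (simp add: le_one top_unique)
qed

lemma lam_eq_top_iff:
  assumes "c \<in> compact_elems"
  shows "lam c = top \<longleftrightarrow> c = 1"
proof
  assume "lam c = top"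
  then have "1 \<le> c"
    using lam_le_iff[OF one_compact assms] by (auto simp: lam_one)
  then show "c = 1"
    by (metis le_one order_antisym)
qed (simp add: lam_one)

text \<open>\<open>lam\<close> sends exactly the nilpotent compact elements to \<open>bot\<close>,
  and semiprimeness leaves only zero. This lets annihilation be read off in the lattice.\<close>

lemma lam_eq_bot_iff:
  assumes "semiprime_quantale TYPE('a)" "c \<in> compact_elems"
  shows "lam c = bot \<longleftrightarrow> c = bot"
proof
  assume "lam c = bot"
  then obtain n where "c ^ n \<le> bot"
    using lam_le_iff[OF assms(2) compact_elems_bot] by (auto simp: lam_bot)
  then show "c = bot"
    using semiprime_power_eq_bot[OF assms(1)] by (simp add: bot_unique)
qed (simp add: lam_bot)

lemma lam_inf_eq_bot_iff:
  assumes "semiprime_quantale TYPE('a)" "c \<in> compact_elems" "d \<in> compact_elems"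
  shows "inf (lam c) (lam d) = bot \<longleftrightarrow> c * d = bot"
  using lam_eq_bot_iff[OF assms(1)] assms by (simp add: mult_compact flip: lam_mult)

lemma lam_sup_eq_top_iff:
  assumes "c \<in> compact_elems" "d \<in> compact_elems"
  shows "sup (lam c) (lam d) = top \<longleftrightarrow> sup c d = 1"
  using lam_eq_top_iff assms by (simp add: compact_elems_sup flip: lam_sup)

text \<open>Lattice witnesses lift to compact elements below the annihilators. Conversely, the
  annihilators are first shrunk to compact elements still joining to \<open>1\<close>, whose images
  are the witnesses.\<close>

lemma conormal_lattice_iff_PF:
  assumes sp: "semiprime_quantale TYPE('a)"
  shows "conormal_lattice TYPE('l) \<longleftrightarrow> PF_quantale TYPE('a)"
proof
  assume con: "conormal_lattice TYPE('l)"
  show "PF_quantale TYPE('a)"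
    unfolding PF_quantale_iff
  proof (intro ballI impI)
    fix c d :: 'a assume cd: "c \<in> compact_elems" "d \<in> compact_elems" "c * d = bot"
    then obtain x y where xy: "inf (lam c) x = bot" "inf (lam d) y = bot" "sup x y = top"
      using con lam_inf_eq_bot_iff[OF sp] unfolding conormal_lattice_def by metis
    obtain u v where "u \<in> compact_elems" "x = lam u" "v \<in> compact_elems" "y = lam v"
      by (metis lam_cases)
    then have "u \<le> annih c" "v \<le> annih d" "sup u v = 1"
      using xy cd by (simp_all add: le_annih_iff lam_inf_eq_bot_iff[OF sp] lam_sup_eq_top_iff)
    then show "sup (annih c) (annih d) = 1"
      by (metis le_one order_antisym sup_mono)
  qed
next
  assume PF: "PF_quantale TYPE('a)"
  show "conormal_lattice TYPE('l)"
    unfolding conormal_lattice_def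
  proof (intro allI impI)
    fix x y :: 'l assume xy: "inf x y = bot"
    obtain c d where cd: "c \<in> compact_elems" "x = lam c" "d \<in> compact_elems" "y = lam d"
      by (metis lam_cases)
    then have "sup (annih c) (annih d) = 1"
      using PF xy by (auto simp: PF_quantale_iff lam_inf_eq_bot_iff[OF sp])
    then obtain u v where "u \<in> compact_elems" "v \<in> compact_elems" "u \<le> annih c" "v \<le> annih d"
      "sup u v = 1"
      by (rule sup_eq_1_compacts)
    then show "\<exists>u v. inf x u = bot \<and> inf y v = bot \<and> sup u v = top"
      using cd by (intro exI[of _ "lam u"] exI[of _ "lam v"])
        (simp add: le_annih_iff lam_inf_eq_bot_iff[OF sp] lam_sup_eq_top_iff)
  qed
qed

text \<open>In both directions \<open>annih c\<close> turns out to be a compact element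
  \<open>d\<close> with a compact complement \<open>f\<close>, and \<open>lam d\<close> is the
  pseudocomplement of \<open>lam c\<close>.\<close>

lemma Stone_lattice_iff_PP:
  assumes sp: "semiprime_quantale TYPE('a)"
  shows "Stone_lattice TYPE('l) \<longleftrightarrow> PP_quantale TYPE('a)"
proof
  assume Stone: "Stone_lattice TYPE('l)"
  show "PP_quantale TYPE('a)"
    unfolding PP_quantale_def complemented_elems_def
  proof (intro ballI CollectI)
    fix c :: 'a assume c: "c \<in> compact_elems"
    obtain x y where x: "{y. inf (lam c) y = bot} = {y. y \<le> x}" and xy: "inf x y = bot" "sup x y = top"
      using Stone unfolding Stone_lattice_def complemented_def by metis
    have x: "inf (lam c) y = bot \<longleftrightarrow> y \<le> x" for y
      using x by blast
    obtain d f where df: "d \<in> compact_elems" "x = lam d" "f \<in> compact_elems" "y = lam f"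
      by (metis lam_cases)
    have eq: "d * f = bot" "sup d f = 1" "c * d = bot"
      using xy x df c lam_inf_eq_bot_iff[OF sp] lam_sup_eq_top_iff by blast+
    have "annih c \<le> d"
    proof (rule le_by_compacts)
      fix z assume z: "z \<in> compact_elems" "z \<le> annih c"
      then have "lam z \<le> lam d"
        using c by (simp add: le_annih_iff lam_inf_eq_bot_iff[OF sp] flip: df(2) x)
      then have "inf (lam z) (lam f) \<le> inf (lam d) (lam f)"
        by (intro inf_mono order_refl)
      then have "inf (lam z) (lam f) = bot"
        using xy(1) by (simp add: bot_unique flip: df(2,4))
      then have "z * f = bot"
        using z df by (simp add: lam_inf_eq_bot_iff[OF sp])
      \<comment> \<open>Multiply \<open>sup d f = 1\<close> by \<open>z\<close>; the summand
        \<open>z * f\<close> vanishes.\<close>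
      then have "z = z * d"
        using eq(2) by (metis mult.right_neutral mult_sup_distrib sup_bot_right)
      then show "z \<le> d"
        by (metis mult_le_right)
    qed
    then have "annih c = d"
      using eq(3) by (simp add: order_antisym le_annih_iff)
    moreover have "f \<le> annih d"
      using eq(1) by (simp add: le_annih_iff)
    ultimately show "sup (annih c) (annih (annih c)) = 1"
      using eq(2) by (metis le_one order_antisym order_refl sup_mono)
  qed
next
  assume PP: "PP_quantale TYPE('a)"
  show "Stone_lattice TYPE('l)"
    unfolding Stone_lattice_def complemented_def
  proof
    fix x :: 'l
    obtain c where c: "c \<in> compact_elems" "x = lam c"
      by (metis lam_cases)
    have "sup (annih c) (annih (annih c)) = 1"
      using PP c by (auto simp: PP_quantale_def complemented_elems_def)
    then obtain d f where df: "d \<in> compact_elems" "f \<in> compact_elems" "d \<le> annih c"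
      "f \<le> annih (annih c)" "sup d f = 1"
      by (rule sup_eq_1_compacts)
    have f: "z * f = bot" if "z \<le> annih c" for z
      using order_trans[OF df(4) annih_anti[OF that]] by (simp add: le_annih_iff)
    have "inf x y = bot \<longleftrightarrow> y \<le> lam d" for y
    proof -
      obtain z where z: "z \<in> compact_elems" "y = lam z"
        by (metis lam_cases)
      show ?thesis
      proof
        assume "inf x y = bot"
        then have "z \<le> annih c"
          using c z by (simp add: le_annih_iff lam_inf_eq_bot_iff[OF sp])
        then have "z * f = bot"
          by (rule f)
        then have "z = z * d"
          using df(5) by (metis mult.right_neutral mult_sup_distrib sup_bot_right)
        then have "z \<le> d"
          by (metis mult_le_right)
        then show "y \<le> lam d"
          using z df(1) lam_mono by blast
      next
        assume "y \<le> lam d"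
        moreover have "inf x (lam d) = bot"
          using c df by (simp add: le_annih_iff lam_inf_eq_bot_iff[OF sp])
        ultimately show "inf x y = bot"
          by (metis bot_unique inf_mono order_refl)
      qed
    qed
    moreover have "inf (lam d) (lam f) = bot" "sup (lam d) (lam f) = top"
      using df f[OF df(3)] by (simp_all add: lam_inf_eq_bot_iff[OF sp] lam_sup_eq_top_iff)
    ultimately show "\<exists>e. (\<exists>f. inf e f = bot \<and> sup e f = top) \<and> {y. inf x y = bot} = {y. y \<le> e}"
      by blast
  qed
qed

section \<open>Primes of the quantale and prime ideals of its reticulation\<close>

definition spec_ideal :: "'a \<Rightarrow> 'l set" where
  "spec_ideal p = {lam c |c. c \<in> compact_elems \<and> c \<le> p}"

text \<open>\<open>lam\<close> identifies compact elements that have powers below each other, and a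
  prime does not distinguish an element from its positive powers. Membership thus does not depend on
  the chosen preimage.\<close>

lemma lam_mem_spec_ideal_iff:
  assumes "p \<in> Spec" "c \<in> compact_elems"
  shows "lam c \<in> spec_ideal p \<longleftrightarrow> c \<le> p"
proof
  assume "lam c \<in> spec_ideal p"
  then obtain d where "d \<in> compact_elems" "d \<le> p" "lam c = lam d"
    by (auto simp: spec_ideal_def)
  moreover from this obtain n where "c ^ n \<le> d"
    using lam_le_iff[OF assms(2)] by (metis order_refl)
  ultimately show "c \<le> p"
    using m_prime_power_le[OF assms(1)] by (meson order_trans)
qed (use assms in \<open>auto simp: spec_ideal_def\<close>)

lemma spec_ideal_subset_iff:
  assumes "p \<in> Spec" "q \<in> Spec"
  shows "spec_ideal p \<subseteq> spec_ideal q \<longleftrightarrow> p \<le> q"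
proof
  assume "spec_ideal p \<subseteq> spec_ideal q"
  then show "p \<le> q"
    using lam_mem_spec_ideal_iff assms by - (rule le_by_compacts, blast)
qed (auto simp: spec_ideal_def intro: order_trans)

lemma prime_lattice_ideal_spec_ideal:
  assumes p: "p \<in> Spec"
  shows "prime_lattice_ideal (spec_ideal p)"
proof -
  note mem = lam_mem_spec_ideal_iff[OF p]
  have "bot \<in> spec_ideal p"
    using mem[OF compact_elems_bot] by (simp add: lam_bot)
  moreover have "top \<notin> spec_ideal p"
    using mem[OF one_compact] m_primeD(1)[OF p] by (simp add: lam_one)
  moreover have "sup x y \<in> spec_ideal p" if xy: "x \<in> spec_ideal p" "y \<in> spec_ideal p" for x y
  proof -
    obtain c d where "c \<in> compact_elems" "x = lam c" "d \<in> compact_elems" "y = lam d"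
      by (metis lam_cases)
    then show ?thesis
      using xy mem by (simp add: compact_elems_sup flip: lam_sup)
  qed
  moreover have "y \<in> spec_ideal p" if xy: "x \<in> spec_ideal p" "y \<le> x" for x y
  proof -
    obtain c d where cd: "c \<in> compact_elems" "x = lam c" "d \<in> compact_elems" "y = lam d"
      by (metis lam_cases)
    \<comment> \<open>The preimage \<open>d\<close> is replaced by \<open>c * d\<close>, which has
      the same image and visibly lies below \<open>p\<close>.\<close>
    then have "lam (c * d) = lam d"
      using xy(2) by (simp add: lam_mult inf_absorb2)
    moreover have "c * d \<le> p"
      using cd xy(1) mem by (metis mult_le_left order_trans)
    ultimately show ?thesis
      using cd mem by (metis mult_compact)
  qed
  moreover have "x \<in> spec_ideal p \<or> y \<in> spec_ideal p" if xy: "inf x y \<in> spec_ideal p" for x y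
  proof -
    obtain c d where cd: "c \<in> compact_elems" "x = lam c" "d \<in> compact_elems" "y = lam d"
      by (metis lam_cases)
    then show ?thesis
      using xy m_primeD(2)[OF p, of c d] by (simp add: mem mult_compact flip: lam_mult)
  qed
  ultimately show ?thesis
    unfolding prime_lattice_ideal_def lattice_ideal_def by (metis UNIV_I)
qed

text \<open>The preimage of \<open>P\<close> is the join of all compact elements that
  \<open>lam\<close> sends into \<open>P\<close>. Compactness and closure of \<open>P\<close> under
  finite joins ensure that no further compact elements come to lie below it.\<close>

lemma spec_ideal_surj:
  assumes P: "prime_lattice_ideal P"
  obtains p where "p \<in> Spec" "P = spec_ideal p"
proof -
  have ideal: "bot \<in> P" "\<And>x y. x \<in> P \<Longrightarrow> y \<in> P \<Longrightarrow> sup x y \<in> P"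
    using P unfolding prime_lattice_ideal_def lattice_ideal_def by blast+
  have "top \<notin> P"
    using prime_lattice_idealD(1,3)[OF P] top_greatest by blast
  define p where "p = Sup {c \<in> compact_elems. lam c \<in> P}"
  have fin: "lam (Sup F) \<in> P" if "finite F" "F \<subseteq> {c \<in> compact_elems. lam c \<in> P}" for F
    using that
  proof (induction)
    case (insert c F)
    then show ?case
      by (simp add: lam_sup compact_elems_Sup ideal(2) subset_eq)
  qed (simp add: lam_bot ideal)
  have mem: "c \<le> p \<longleftrightarrow> lam c \<in> P" if c: "c \<in> compact_elems" for c
  proof
    assume "c \<le> p"
    then obtain F where F: "finite F" "F \<subseteq> {c \<in> compact_elems. lam c \<in> P}" "c \<le> Sup F"
      using compact_le_Sup_finite[OF c] unfolding p_def by blast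
    then have "Sup F \<in> compact_elems"
      by (auto intro!: compact_elems_Sup)
    then have "lam c \<le> lam (Sup F)"
      using lam_mono[OF c] F by blast
    then show "lam c \<in> P"
      using fin[OF F(1,2)] prime_lattice_idealD(1)[OF P] by blast
  qed (use c in \<open>auto simp: p_def intro: Sup_upper\<close>)
  have "m_prime p"
    unfolding m_prime_def
  proof (intro conjI allI impI)
    show "p < 1"
      using mem[OF one_compact] \<open>top \<notin> P\<close> le_one by (metis lam_one order_le_less order_refl)
    fix a b assume ab: "a * b \<le> p"
    show "a \<le> p \<or> b \<le> p"
    proof (rule ccontr)
      assume "\<not> (a \<le> p \<or> b \<le> p)"
      \<comment> \<open>Primeness for arbitrary \<open>a\<close> and \<open>b\<close> is reduced to
        compact elements, where the ideal \<open>P\<close> can decide.\<close>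
      then obtain c d where cd: "c \<in> compact_elems" "c \<le> a" "\<not> c \<le> p"
        "d \<in> compact_elems" "d \<le> b" "\<not> d \<le> p"
        using le_by_compacts by metis
      then have "c * d \<le> p"
        using ab mult_mono_quantale order_trans by blast
      then have "inf (lam c) (lam d) \<in> P"
        using mem cd by (simp add: mult_compact flip: lam_mult)
      then show False
        using prime_lattice_idealD(2)[OF P] mem cd by blast
    qed
  qed
  moreover have "P = spec_ideal p"
  proof -
    have "x \<in> P \<longleftrightarrow> x \<in> spec_ideal p" for x
    proof -
      obtain c where "c \<in> compact_elems" "x = lam c"
        by (metis lam_cases)
      then show ?thesis
        using mem lam_mem_spec_ideal_iff \<open>m_prime p\<close> by (simp add: Spec_def)
    qed
    then show ?thesis by blast
  qed
  ultimately show ?thesis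
    using that by (simp add: Spec_def)
qed

lemma spec_ideal_image_Min_Spec: "spec_ideal ` Min_Spec = min_prime_ideals"
proof (intro set_eqI iffI)
  fix P assume "P \<in> spec_ideal ` Min_Spec"
  then obtain p where p: "p \<in> Min_Spec" "P = spec_ideal p" by blast
  then have pS: "p \<in> Spec" by (simp add: Min_Spec_def)
  have "Q = P" if Q: "prime_lattice_ideal Q" "Q \<subseteq> P" for Q
  proof -
    obtain q where q: "q \<in> Spec" "Q = spec_ideal q"
      using spec_ideal_surj[OF Q(1)] by blast
    then show ?thesis
      using p Q(2) pS by (auto simp: Min_Spec_def spec_ideal_subset_iff)
  qed
  then show "P \<in> min_prime_ideals"
    using p pS prime_lattice_ideal_spec_ideal by (auto simp: min_prime_ideals_def)
next
  fix P :: "'l set" assume P: "P \<in> min_prime_ideals"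
  then obtain p where p: "p \<in> Spec" "P = spec_ideal p"
    using spec_ideal_surj[of P] by (auto simp: min_prime_ideals_def)
  have "q = p" if q: "q \<in> Spec" "q \<le> p" for q
  proof -
    have "spec_ideal q = spec_ideal p"
      using P p q prime_lattice_ideal_spec_ideal[OF q(1)] spec_ideal_subset_iff[OF q(1) p(1)]
      by (auto simp: min_prime_ideals_def)
    then show ?thesis
      using spec_ideal_subset_iff[OF p(1) q(1)] q(2) by (simp add: order_antisym)
  qed
  then show "P \<in> spec_ideal ` Min_Spec"
    using p by (auto simp: Min_Spec_def)
qed

text \<open>The order isomorphism between primes and prime ideals restricts to the minimal ones and
  matches the basic open set of a compact \<open>c\<close> with that of
  \<open>lam c\<close>.\<close>

lemma homeomorphic_map_spec_ideal: "homeomorphic_map Min_Z Min_Id_Z spec_ideal"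
proof (rule bijective_open_imp_homeomorphic_map)
  have basic: "spec_ideal ` {p \<in> Min_Spec. \<not> c \<le> p} = {P \<in> min_prime_ideals. lam c \<notin> P}"
    if "c \<in> compact_elems" for c
    using lam_mem_spec_ideal_iff[OF _ that] Min_Spec_subset
    by (auto simp: image_iff simp flip: spec_ideal_image_Min_Spec)
  show "continuous_map Min_Z Min_Id_Z spec_ideal"
  proof (rule continuous_map_into_topology_base)
    show "spec_ideal p \<in> topspace Min_Id_Z" if "p \<in> topspace Min_Z" for p
      using that spec_ideal_image_Min_Spec by (auto simp: topspace_Min_Z topspace_Min_Id_Z)
    show "openin Min_Id_Z = arbitrary union_of (\<lambda>U. \<exists>x. U = {P \<in> min_prime_ideals. x \<notin> P})"
      by (rule openin_Min_Id_Z)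
    fix U :: "'l set set" assume "\<exists>x. U = {P \<in> min_prime_ideals. x \<notin> P}"
    then obtain c where c: "c \<in> compact_elems" "U = {P \<in> min_prime_ideals. lam c \<notin> P}"
      by (metis lam_cases)
    have "{p \<in> topspace Min_Z. spec_ideal p \<in> U} = {p \<in> Min_Spec. \<not> c \<le> p}"
      using lam_mem_spec_ideal_iff[OF _ c(1)] Min_Spec_subset spec_ideal_image_Min_Spec
      by (auto simp: topspace_Min_Z c(2))
    then show "openin Min_Z {p \<in> topspace Min_Z. spec_ideal p \<in> U}"
      by (simp add: openin_Min_Z_basic)
  qed
  show "open_map Min_Z Min_Id_Z spec_ideal"
    unfolding open_map_def
  proof (intro allI impI)
    fix U :: "'a set" assume "openin Min_Z U"
    then obtain a where a: "U = {p \<in> Min_Spec. \<not> a \<le> p}"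
      by (auto simp: openin_Min_Z)
    \<comment> \<open>Open sets of \<open>Min_Z\<close> come from arbitrary elements, which must be
      split into compact ones before \<open>lam\<close> can be applied.\<close>
    have "U = (\<Union>c\<in>{c \<in> compact_elems. c \<le> a}. {p \<in> Min_Spec. \<not> c \<le> p})"
      unfolding a using le_by_compacts[of a] by (auto intro: order_trans)
    then have "spec_ideal ` U =
        (\<Union>c\<in>{c \<in> compact_elems. c \<le> a}. {P \<in> min_prime_ideals. lam c \<notin> P})"
      by (simp add: image_UN basic)
    also have "openin Min_Id_Z \<dots>"
      by (intro openin_Union) (auto simp: openin_Min_Id_Z intro!: arbitrary_union_of_inc)
    finally show "openin Min_Id_Z (spec_ideal ` U)" .
  qed
  show "spec_ideal ` topspace Min_Z = topspace Min_Id_Z"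
    by (simp add: topspace_Min_Z topspace_Min_Id_Z spec_ideal_image_Min_Spec)
  show "inj_on spec_ideal (topspace Min_Z)"
    unfolding topspace_Min_Z
  proof (rule inj_onI)
    fix p q :: 'a assume "p \<in> Min_Spec" "q \<in> Min_Spec" and eq: "spec_ideal p = spec_ideal q"
    then have "p \<in> Spec" "q \<in> Spec"
      using Min_Spec_subset by blast+
    then show "p = q"
      using spec_ideal_subset_iff eq by (metis order_antisym order_refl)
  qed
qed

lemma compact_space_Min_Id_Z_iff:
  "compact_space (Min_Id_Z :: 'l set topology) \<longleftrightarrow> compact_space (Min_Z :: 'a topology)"
  using homeomorphic_compact_space homeomorphic_map_imp_homeomorphic_space homeomorphic_map_spec_ideal
  by blast

end

theorem theorem8p5:
  fixes lam :: "'a::coherent_quantale \<Rightarrow> 'l::{bounded_lattice,distrib_lattice}"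
  assumes "semiprime_quantale TYPE('a)"
    and "reticulation lam"
  shows "(PP_quantale TYPE('a)
            \<longleftrightarrow> Stone_lattice TYPE('l))
       \<and> (PP_quantale TYPE('a)
            \<longleftrightarrow> conormal_lattice TYPE('l) \<and> compact_space (Min_Id_Z :: 'l set topology))
       \<and> (PP_quantale TYPE('a)
            \<longleftrightarrow> PF_quantale TYPE('a) \<and> compact_space (Min_Z :: 'a topology))
       \<and> (PP_quantale TYPE('a)
            \<longleftrightarrow> PF_quantale TYPE('a) \<and> Boolean_space (Min_Z :: 'a topology))
       \<and> (PP_quantale TYPE('a)
            \<longleftrightarrow> mp_quantale TYPE('a) \<and> Boolean_space (Min_Z :: 'a topology))
       \<and> (PP_quantale TYPE('a)
            \<longleftrightarrow> normal_space (Spec_F :: 'a topology) \<and> Boolean_space (Min_Z :: 'a topology))"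
proof -
  note sp = assms(1)
  have PP: "PP_quantale TYPE('a) \<longleftrightarrow> PF_quantale TYPE('a) \<and> compact_space (Min_Z :: 'a topology)"
    using PP_imp_PF PP_imp_compact_Min_Z[OF sp] PF_compact_imp_PP[OF sp] by blast
  have normal: "normal_space (Spec_F :: 'a topology) \<longleftrightarrow> PF_quantale TYPE('a)"
    using PF_imp_normal_Spec_F[OF sp] normal_Spec_F_imp_mp PF_iff_mp[OF sp] by blast
  show ?thesis
    \<comment> \<open>After these rewrites every condition is either PP itself or the conjunction of
      PF with compactness of \<open>Min_Z\<close>.\<close>
    unfolding Stone_lattice_iff_PP[OF assms(2) sp] conormal_lattice_iff_PF[OF assms(2) sp]
      compact_space_Min_Id_Z_iff[OF assms(2)] Boolean_space_Min_Z_iff[OF sp] normal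
      PF_iff_mp[OF sp, symmetric]
    using PP by blast
qed

end
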